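(* The $3$-MEDA problem (Minimum Exact Diameter-$3$ Augmentation) is solvable in polynomial time. That is, there is a polynomial-time algorithm which, given a connected graph $G$ and a positive integer $k$, decides whether there is a set $F\subseteq E(G)$ such that $|F|\le k$ and $G-F$ is a connected graph of diameter exactly $3$.
   Context: All graphs are finite, simple and undirected. For $F\subseteq E(G)$, $G-F$ is the graph with vertex set $V(G)$ and edge set $E(G)\setminus F$. The diameter of a connected graph $G$ is $\mathrm{diam}(G)=\max_{u,v\in V(G)}\mathrm{dist}_G(u,v)$, where $\mathrm{dist}_G(u,v)$ is the minimum number of edges of a $u,v$-path. For a fixed positive integer $d$, the Minimum Exact Diameter-$d$ Augmentation problem ($d$-MEDA) is the following decision problem. Input: a connected graph $G$ and a positive integer $k$. Question: is there a set $F\subseteq E(G)$ such that $|F|\le k$ and $G-F$ is a connected graph of diameter $d$? *)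

theory Defs
  imports Main "HOL-Computational_Algebra.Polynomial"
begin

section \<open>Graphs\<close>

text \<open>A graph is a pair of a vertex set and a set of edges, each edge being a two-element set of vertices.\<close>

type_synonym 'a graph = "'a set \<times> 'a set set"

abbreviation verts :: "'a graph \<Rightarrow> 'a set" where "verts G \<equiv> fst G"
abbreviation edges :: "'a graph \<Rightarrow> 'a set set" where "edges G \<equiv> snd G"

definition simple_graph :: "'a graph \<Rightarrow> bool" where
  "simple_graph G \<longleftrightarrow>
     finite (verts G) \<and> edges G \<subseteq> {{u, v} | u v. u \<in> verts G \<and> v \<in> verts G \<and> u \<noteq> v}"

definition del_edges :: "'a graph \<Rightarrow> 'a set set \<Rightarrow> 'a graph" where
  "del_edges G F = (verts G, edges G - F)"

text \<open>A path is given by its list of vertices, so one with \<open>l\<close> edges has length \<open>Suc l\<close>.\<close>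

definition is_path :: "'a graph \<Rightarrow> 'a \<Rightarrow> 'a \<Rightarrow> 'a list \<Rightarrow> bool" where
  "is_path G u v p \<longleftrightarrow>
     p \<noteq> [] \<and> hd p = u \<and> last p = v \<and> distinct p \<and> set p \<subseteq> verts G \<and>
     successively (\<lambda>x y. {x, y} \<in> edges G) p"

definition connected_graph :: "'a graph \<Rightarrow> bool" where
  "connected_graph G \<longleftrightarrow>
     verts G \<noteq> {} \<and> (\<forall>u\<in>verts G. \<forall>v\<in>verts G. \<exists>p. is_path G u v p)"

text \<open>The values of \<open>graph_dist\<close> and \<open>diam\<close> are meaningful for (finite) connected graphs only.\<close>

definition graph_dist :: "'a graph \<Rightarrow> 'a \<Rightarrow> 'a \<Rightarrow> nat" where
  "graph_dist G u v = (LEAST l. \<exists>p. is_path G u v p \<and> length p = Suc l)"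

definition diam :: "'a graph \<Rightarrow> nat" where
  "diam G = Max {graph_dist G u v | u v. u \<in> verts G \<and> v \<in> verts G}"


section \<open>Polynomial time\<close>

text \<open>
  The machine model is a random access machine with structured control flow. It has registers
  and an indirectly addressed memory, both holding natural numbers. The only arithmetic operations
  are addition and truncated subtraction, each at unit cost. As there is no multiplication, a
  number computed in \<open>t\<close> steps from an input of \<open>m\<close> bits has \<open>O(t + m)\<close> bits; hence
  polynomial time on this machine is polynomial time on Turing machines.
\<close>

type_synonym reg = nat

datatype com =
    Skip
  | Const reg nat
  | Add reg reg reg
  | Sub reg reg reg
  | Load reg reg
  | Store reg reg
  | Seq com com
  | IfNZ reg com com
  | WhileNZ reg com

type_synonym state = "(reg \<Rightarrow> nat) \<times> (nat \<Rightarrow> nat)"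

text \<open>\<open>exec c s t s'\<close>: started in \<open>s\<close>, the program \<open>c\<close> halts in \<open>s'\<close> after exactly \<open>t\<close> steps.
  A register counts as true in a test iff it is nonzero.\<close>

inductive exec :: "com \<Rightarrow> state \<Rightarrow> nat \<Rightarrow> state \<Rightarrow> bool" where
  Skip: "exec Skip s 1 s"
| Const: "exec (Const x n) (r, m) 1 (r(x := n), m)"
| Add: "exec (Add x y z) (r, m) 1 (r(x := r y + r z), m)"
| Sub: "exec (Sub x y z) (r, m) 1 (r(x := r y - r z), m)"
| Load: "exec (Load x y) (r, m) 1 (r(x := m (r y)), m)"
| Store: "exec (Store x y) (r, m) 1 (r, m(r x := r y))"
| Seq: "exec c1 s1 t1 s2 \<Longrightarrow> exec c2 s2 t2 s3 \<Longrightarrow> exec (Seq c1 c2) s1 (t1 + t2) s3"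
| IfTrue: "fst s x \<noteq> 0 \<Longrightarrow> exec c1 s t s' \<Longrightarrow> exec (IfNZ x c1 c2) s (Suc t) s'"
| IfFalse: "fst s x = 0 \<Longrightarrow> exec c2 s t s' \<Longrightarrow> exec (IfNZ x c1 c2) s (Suc t) s'"
| WhileFalse: "fst s x = 0 \<Longrightarrow> exec (WhileNZ x c) s 1 s"
| WhileTrue: "fst s1 x \<noteq> 0 \<Longrightarrow> exec c s1 t1 s2 \<Longrightarrow> exec (WhileNZ x c) s2 t2 s3 \<Longrightarrow>
    exec (WhileNZ x c) s1 (Suc (t1 + t2)) s3"

inductive_cases exec_elims:
  "exec Skip s t s'"
  "exec (Const x n) s t s'"
  "exec (Add x y z) s t s'"
  "exec (Sub x y z) s t s'"
  "exec (Load x y) s t s'"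
  "exec (Store x y) s t s'"
  "exec (Seq c1 c2) s t s'"
  "exec (IfNZ x c1 c2) s t s'"
  "exec (WhileNZ x c) s t s'"

lemma exec_deterministic:
  "exec c s t s' \<Longrightarrow> exec c s u s'' \<Longrightarrow> u = t \<and> s'' = s'"
proof (induction arbitrary: u s'' rule: exec.induct)
  case (Seq c1 s1 t1 s2 c2 t2 s3)
  from Seq.prems show ?case
  proof (rule exec_elims(7))
    fix v1 r v2
    assume "u = v1 + v2" "exec c1 s1 v1 r" "exec c2 r v2 s''"
    with Seq.IH(1)[of v1 r] Seq.IH(2)[of v2 s''] show ?thesis by simp
  qed
next
  case (IfTrue s x c1 t s' c2)
  from IfTrue.prems show ?case
  proof (rule exec_elims(8))
    fix v
    assume "u = Suc v" "exec c1 s v s''"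
    with IfTrue.IH[of v s''] show ?thesis by simp
  qed (use IfTrue.hyps in simp)
next
  case (IfFalse s x c2 t s' c1)
  from IfFalse.prems show ?case
  proof (rule exec_elims(8))
    fix v
    assume "u = Suc v" "exec c2 s v s''"
    with IfFalse.IH[of v s''] show ?thesis by simp
  qed (use IfFalse.hyps in simp)
next
  case (WhileFalse s x c)
  from WhileFalse.prems show ?case
    by (rule exec_elims(9)) (use WhileFalse.hyps in simp_all)
next
  case (WhileTrue s1 x c t1 s2 t2 s3)
  from WhileTrue.prems show ?case
  proof (rule exec_elims(9))
    fix v1 r v2
    assume "u = Suc (v1 + v2)" "exec c s1 v1 r" "exec (WhileNZ x c) r v2 s''"
    with WhileTrue.IH(1)[of v1 r] WhileTrue.IH(2)[of v2 s''] show ?thesis by simp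
  qed (use WhileTrue.hyps(1) in simp)
qed (erule exec_elims(1-6); simp)+

text \<open>The input bits are stored in memory from address 0 on, register 0 holds their number, and
  everything else is 0. The answer is read off register 0.\<close>

definition init_state :: "bool list \<Rightarrow> state" where
  "init_state w =
     ((\<lambda>x. if x = 0 then length w else 0), (\<lambda>i. if i < length w then of_bool (w ! i) else 0))"

definition accepting :: "state \<Rightarrow> bool" where
  "accepting s \<longleftrightarrow> fst s 0 \<noteq> 0"

text \<open>A decision problem is given by a set of instances, the property to be decided, and an encoding
  of the instances as bit strings. The running time is measured in the length of the encoding.\<close>

definition polytime_solvable :: "('i \<Rightarrow> bool list) \<Rightarrow> 'i set \<Rightarrow> ('i \<Rightarrow> bool) \<Rightarrow> bool" where
  "polytime_solvable enc Inst Q \<longleftrightarrow>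
     (\<exists>(c :: com) (p :: nat poly). \<forall>x\<in>Inst. \<exists>t s.
        exec c (init_state (enc x)) t s \<and> t \<le> poly p (length (enc x)) \<and> (accepting s \<longleftrightarrow> Q x))"


section \<open>Minimum Exact Diameter-\<open>d\<close> Augmentation\<close>

text \<open>As usual for algorithmic inputs, the vertices of an input graph are numbered \<open>0, \<dots>, n - 1\<close>.\<close>

definition meda_instances :: "(nat graph \<times> nat) set" where
  "meda_instances =
     {(G, k). simple_graph G \<and> (\<exists>n. verts G = {..<n}) \<and> connected_graph G \<and> 0 < k}"

definition meda_yes :: "nat \<Rightarrow> nat graph \<times> nat \<Rightarrow> bool" where
  "meda_yes d = (\<lambda>(G, k). \<exists>F \<subseteq> edges G. card F \<le> k \<and>
     connected_graph (del_edges G F) \<and> diam (del_edges G F) = d)"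

text \<open>Binary representation, least significant bit first.\<close>

fun binary :: "nat \<Rightarrow> bool list" where
  "binary n = (if n = 0 then [] else odd n # binary (n div 2))"

declare binary.simps [simp del]

text \<open>The number of vertices in unary, a separator, the adjacency matrix row by row, and \<open>k\<close> in binary.\<close>

definition meda_encode :: "nat graph \<times> nat \<Rightarrow> bool list" where
  "meda_encode = (\<lambda>(G, k). let n = card (verts G) in
     replicate n True @ [False] @
     concat (map (\<lambda>i. map (\<lambda>j. {i, j} \<in> edges G) [0..<n]) [0..<n]) @
     binary k)"

end

theory Submission imports Defs begin

text \<open>
  Deleting edges only increases distances, so the problem is trivial unless \<open>diam G \<le> 2\<close>. Then some
  pair \<open>u, v\<close> must be brought to distance at least 3, which costs the edge \<open>uv\<close> (if present) and
  one edge for each common neighbour \<open>c\<close>; nothing else ever has to be deleted. The remaining choice,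
  whether \<open>c\<close> stays attached to \<open>u\<close> or to \<open>v\<close>, is a 2-colouring. All distances stay at most 3 if
  each \<open>c\<close> has a neighbour of the opposite colour or, when it has no neighbour in \<open>N(u) \<union> N(v)\<close>
  at all, a vertex of the opposite colour within distance 2 avoiding \<open>u, v\<close>. Such a colouring is
  built greedily, provided each \<open>c\<close> has any other vertex of \<open>N(u) \<union> N(v)\<close> within distance 2 in
  \<open>G - u - v\<close>. This and an edge joining \<open>N(u) - v\<close> to \<open>N(v) - u\<close> are also necessary. The only case in
  which they do not suffice for the pair \<open>u, v\<close> has another pair of cost 1. Hence it is enough to
  test all pairs by a formula with bounded quantifiers and counting, which is compiled to the machine.
\<close>

section \<open>Distances\<close>

abbreviation adj :: "'a graph \<Rightarrow> 'a \<Rightarrow> 'a \<Rightarrow> bool" where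
  "adj G x y \<equiv> {x, y} \<in> edges G"

text \<open>A step may stay put, so this is distance at most \<open>l\<close> without any minimum,
  and it unfolds to a first-order formula for \<open>l = 2\<close> and \<open>l = 3\<close>. Taking
  a bare relation instead of a graph makes a deletion a mere change of \<open>E\<close>.\<close>

primrec reach :: "('a \<Rightarrow> 'a \<Rightarrow> bool) \<Rightarrow> nat \<Rightarrow> 'a \<Rightarrow> 'a \<Rightarrow> bool" where
  "reach E 0 x y \<longleftrightarrow> x = y"
| "reach E (Suc l) x y \<longleftrightarrow> (\<exists>z. (x = z \<or> E x z) \<and> reach E l z y)"

lemma reach_refl: "reach E l x x"
  by (induction l) auto

lemma reach_mono: "reach E l x y \<Longrightarrow> (\<And>x y. E x y \<Longrightarrow> E' x y) \<Longrightarrow> reach E' l x y"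
  by (induction l arbitrary: x) (simp, fastforce)

lemma reach_2: "reach E 2 x y \<longleftrightarrow> (\<exists>z. (x = z \<or> E x z) \<and> (z = y \<or> E z y))"
  by (auto simp: numeral_eq_Suc)

lemma reach_3:
  "reach E 3 x y \<longleftrightarrow> (\<exists>z w. (x = z \<or> E x z) \<and> (z = w \<or> E z w) \<and> (w = y \<or> E w y))"
  by (auto simp: numeral_eq_Suc)

lemma reach_2_cases: "reach E 2 x y \<longleftrightarrow> x = y \<or> E x y \<or> (\<exists>z. E x z \<and> E z y)"
  by (auto simp: reach_2)

lemma path_imp_reach:
  assumes "is_path G u v p" "length p \<le> Suc l"
  shows "reach (adj G) l u v"
  using assms
proof (induction l arbitrary: u p)
  case 0
  then have "length p = Suc 0" by (cases p) (auto simp: is_path_def)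
  then show ?case using 0 by (auto simp: is_path_def length_Suc_conv)
next
  case (Suc l)
  from Suc.prems obtain q where p: "p = u # q" by (cases p) (auto simp: is_path_def)
  show ?case
  proof (cases q)
    case Nil
    then show ?thesis using Suc.prems p by (auto simp: is_path_def reach_refl)
  next
    case (Cons z q')
    then have "is_path G z v q" "adj G u z" using Suc.prems p by (auto simp: is_path_def)
    then show ?thesis using Suc.IH[of z q] Suc.prems p by auto
  qed
qed

text \<open>A walk is shortened to a path from its front: if the new first vertex already lies on
  the path, the segment before it is dropped. Only the target must be known to be a vertex; the
  others are ends of edges.\<close>

lemma reach_imp_path:
  assumes "simple_graph G" "v \<in> verts G" "reach (adj G) l u v"
  shows "\<exists>p. is_path G u v p \<and> length p \<le> Suc l"
  using assms(3)
proof (induction l arbitrary: u)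
  case 0
  then have "is_path G u v [u]" using assms by (auto simp: is_path_def)
  then show ?case by auto
next
  case (Suc l)
  then obtain z where z: "u = z \<or> adj G u z" "reach (adj G) l z v" by auto
  from Suc.IH[OF z(2)] obtain p where p: "is_path G z v p" "length p \<le> Suc l" by auto
  show ?case
  proof (cases "u \<in> set p")
    case True
    then obtain a b where ab: "p = a @ u # b" by (auto dest: split_list)
    have "is_path G u v (u # b)"
      using p(1) ab by (auto simp: is_path_def successively_append_iff)
    then show ?thesis using p(2) ab by (intro exI[of _ "u # b"]) auto
  next
    case False
    have "p \<noteq> []" "hd p = z" using p(1) by (auto simp: is_path_def)
    then have "u \<noteq> z" using False by force
    with z have uz: "adj G u z" by simp
    then have "u \<in> verts G" using assms(1) by (force simp: simple_graph_def doubleton_eq_iff)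
    then have "is_path G u v (u # p)"
      using p(1) uz False by (auto simp: is_path_def successively_Cons)
    then show ?thesis using p(2) by (intro exI[of _ "u # p"]) auto
  qed
qed

lemma connected_graph_if_reach:
  assumes "simple_graph G" "verts G \<noteq> {}"
    and "\<And>u v. u \<in> verts G \<Longrightarrow> v \<in> verts G \<Longrightarrow> reach (adj G) l u v"
  shows "connected_graph G"
  using assms reach_imp_path unfolding connected_graph_def by metis

lemma graph_dist_le_iff:
  assumes "simple_graph G" "connected_graph G" "u \<in> verts G" "v \<in> verts G"
  shows "graph_dist G u v \<le> l \<longleftrightarrow> reach (adj G) l u v"
proof
  from assms obtain p where p: "is_path G u v p" by (auto simp: connected_graph_def)
  then have "length p = Suc (length p - 1)" by (cases p) (auto simp: is_path_def)
  with p have "\<exists>l p. is_path G u v p \<and> length p = Suc l" by metis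
  from LeastI_ex[OF this] obtain q where q: "is_path G u v q" "length q = Suc (graph_dist G u v)"
    unfolding graph_dist_def by blast
  assume "graph_dist G u v \<le> l"
  then show "reach (adj G) l u v" using q by (intro path_imp_reach[of _ _ _ q]) auto
next
  assume "reach (adj G) l u v"
  then obtain p where p: "is_path G u v p" "length p \<le> Suc l"
    using reach_imp_path assms by metis
  then have "length p = Suc (length p - 1)" by (cases p) (auto simp: is_path_def)
  with p have "graph_dist G u v \<le> length p - 1"
    unfolding graph_dist_def by (intro Least_le) auto
  then show "graph_dist G u v \<le> l" using p(2) by simp
qed

lemma diam_le_iff:
  assumes "simple_graph G" "connected_graph G"
  shows "diam G \<le> l \<longleftrightarrow> (\<forall>u\<in>verts G. \<forall>v\<in>verts G. reach (adj G) l u v)"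
proof -
  let ?D = "{graph_dist G u v | u v. u \<in> verts G \<and> v \<in> verts G}"
  have "?D = (\<lambda>(u, v). graph_dist G u v) ` (verts G \<times> verts G)" by auto
  moreover have "finite (verts G)" "verts G \<noteq> {}"
    using assms by (auto simp: simple_graph_def connected_graph_def)
  ultimately have "finite ?D" "?D \<noteq> {}" by auto
  then have "diam G \<le> l \<longleftrightarrow> (\<forall>d\<in>?D. d \<le> l)"
    unfolding diam_def by (rule Max_le_iff)
  also have "\<dots> \<longleftrightarrow> (\<forall>u\<in>verts G. \<forall>v\<in>verts G. reach (adj G) l u v)"
    using graph_dist_le_iff[OF assms] by blast
  finally show ?thesis .
qed

text \<open>The condition with \<open>reach (adj G) 3\<close> already implies connectedness, so
  \<open>diam\<close>, which is meaningful for connected graphs only, can be eliminated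
  altogether.\<close>

lemma connected_diam_3_iff:
  assumes "simple_graph G" "verts G \<noteq> {}"
  shows "connected_graph G \<and> diam G = 3 \<longleftrightarrow>
    (\<forall>u\<in>verts G. \<forall>v\<in>verts G. reach (adj G) 3 u v) \<and>
    (\<exists>u\<in>verts G. \<exists>v\<in>verts G. \<not> reach (adj G) 2 u v)"
proof -
  have "diam G = 3 \<longleftrightarrow> diam G \<le> 3 \<and> \<not> diam G \<le> 2" by auto
  then show ?thesis
    using diam_le_iff[OF assms(1), of 3] diam_le_iff[OF assms(1), of 2]
      connected_graph_if_reach[OF assms, of 3] by blast
qed

section \<open>Separating a pair of vertices\<close>

text \<open>The walk \<open>c, z, w\<close> avoids \<open>u\<close> and \<open>v\<close>, so it
  survives any deletion confined to edges at \<open>u\<close> or \<open>v\<close>; it may stutter,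
  which covers \<open>w\<close> adjacent to \<open>c\<close>. In the last conjunct \<open>s\<close>
  and \<open>t\<close> may be common neighbours as well.\<close>

definition separable :: "('a \<Rightarrow> 'a \<Rightarrow> bool) \<Rightarrow> 'a \<Rightarrow> 'a \<Rightarrow> bool" where
  "separable E u v \<longleftrightarrow> u \<noteq> v \<and>
     (\<forall>c. E u c \<and> E v c \<longrightarrow>
       (\<exists>z w. z \<notin> {u, v} \<and> w \<notin> {u, v, c} \<and> (E u w \<or> E v w) \<and> (c = z \<or> E c z) \<and> (z = w \<or> E z w))) \<and>
     (\<exists>s t. E u s \<and> s \<noteq> v \<and> E v t \<and> t \<noteq> u \<and> E s t)"

definition sep_cost :: "('a \<Rightarrow> 'a \<Rightarrow> bool) \<Rightarrow> 'a \<Rightarrow> 'a \<Rightarrow> nat" where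
  "sep_cost E u v = card {c. E u c \<and> E v c} + of_bool (E u v)"

text \<open>\<open>D\<close> is coloured in advance by \<open>g\<close>. A vertex of
  \<open>C\<close> with a partner in \<open>D\<close> gets the colour opposite to that partner. If
  there is no such vertex, some vertex and its partner in \<open>C\<close> are coloured oppositely
  at once, and symmetry of \<open>P\<close> satisfies both. Coloured vertices move to
  \<open>D\<close>, so \<open>C \<union> D\<close> and the hypothesis about it persist.\<close>

lemma opposite_colouring:
  fixes P :: "'a \<Rightarrow> 'a \<Rightarrow> bool" and g :: "'a \<Rightarrow> bool"
  assumes "finite C" "C \<inter> D = {}" "\<And>x y. P x y \<Longrightarrow> P y x"
    and "\<And>c. c \<in> C \<Longrightarrow> \<exists>w\<in>C \<union> D. w \<noteq> c \<and> P c w"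
  shows "\<exists>h. (\<forall>x\<in>D. h x = g x) \<and> (\<forall>c\<in>C. \<exists>w\<in>C \<union> D. P c w \<and> h w \<noteq> h c)"
  using assms(1,2,4)
proof (induction "card C" arbitrary: C D g rule: less_induct)
  case less
  show ?case
  proof (cases "\<exists>c\<in>C. \<exists>w\<in>D. P c w")
    case True
    then obtain c w where cw: "c \<in> C" "w \<in> D" "P c w" by auto
    let ?C = "C - {c}" and ?D = "insert c D" and ?g = "g(c := \<not> g w)"
    have eq: "?C \<union> ?D = C \<union> D" using cw by auto
    have "card ?C < card C" using less.prems cw by (meson card_Diff1_less)
    from less.hyps[OF this, of ?D ?g] less.prems
    obtain h where h: "\<forall>x\<in>?D. h x = ?g x" "\<forall>c\<in>?C. \<exists>w\<in>C \<union> D. P c w \<and> h w \<noteq> h c"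
      unfolding eq by auto
    have "c \<notin> D" using cw less.prems by auto
    then have "h w \<noteq> h c" "\<forall>x\<in>D. h x = g x" using h(1) cw by auto
    then show ?thesis using h(2) cw by (intro exI[of _ h]) blast
  next
    case no_D: False
    show ?thesis
    proof (cases "C = {}")
      case False
      then obtain c where c: "c \<in> C" by auto
      then obtain w where w: "w \<in> C" "w \<noteq> c" "P c w" using less.prems(3)[OF c] no_D by blast
      let ?C = "C - {c, w}" and ?D = "{c, w} \<union> D" and ?g = "g(c := True, w := False)"
      have eq: "?C \<union> ?D = C \<union> D" using c w by auto
      have "card ?C < card C" using less.prems c by (intro psubset_card_mono) auto
      from less.hyps[OF this, of ?D ?g] less.prems
      obtain h where h: "\<forall>x\<in>?D. h x = ?g x" "\<forall>c\<in>?C. \<exists>w\<in>C \<union> D. P c w \<and> h w \<noteq> h c"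
        unfolding eq by auto
      have "c \<notin> D" "w \<notin> D" using c w less.prems by auto
      then have "h c" "\<not> h w" "\<forall>x\<in>D. h x = g x" using h(1) w by auto
      then show ?thesis using h(2) c w assms(3)[OF w(3)] by (intro exI[of _ h]) blast
    qed auto
  qed
qed

section \<open>Graphs of diameter at most 2, and the necessity of separability\<close>

locale diameter_2 =
  fixes V :: "'a set" and E :: "'a \<Rightarrow> 'a \<Rightarrow> bool"
  assumes fin: "finite V"
    and sym: "E x y \<Longrightarrow> E y x"
    and irrefl: "\<not> E x x"
    and in_V: "E x y \<Longrightarrow> x \<in> V"
    and dist_2: "x \<in> V \<Longrightarrow> y \<in> V \<Longrightarrow> x = y \<or> E x y \<or> (\<exists>z. E x z \<and> E z y)"
begin

lemma finite_nbrs: "finite {c. E u c \<and> E v c}"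
  by (rule finite_subset[OF _ fin]) (auto intro: in_V sym)

text \<open>\<open>E'\<close> is the surviving adjacency and \<open>c\<close> a common neighbour cut
  off from \<open>v\<close>. A surviving walk of length at most 3 from \<open>c\<close> to
  \<open>v\<close> enters \<open>v\<close> from a vertex other than \<open>c\<close>, which serves
  as \<open>w\<close>. The walk cannot pass through \<open>u\<close>, as \<open>u\<close> would then
  be within distance 2 of \<open>v\<close>.\<close>

lemma separable_detour:
  assumes F: "\<And>x y. E' x y \<Longrightarrow> E x y" "\<And>x y. E' x y \<Longrightarrow> E' y x"
    and far: "\<not> reach E' 2 u v" and near: "reach E' 3 c v"
    and c: "\<not> E' v c" "E u c" "E v c"
  shows "\<exists>z w. z \<notin> {u, v} \<and> w \<notin> {u, v, c} \<and> (E u w \<or> E v w) \<and> (c = z \<or> E c z) \<and> (z = w \<or> E z w)"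
proof -
  have uv: "\<not> E' u v" "\<And>z. E' u z \<Longrightarrow> \<not> E' z v" "u \<noteq> v"
    using far by (auto simp: reach_2_cases)
  have cv: "c \<noteq> v" "c \<noteq> u" "\<not> E' c v" using c irrefl F(2) by auto
  obtain z w where zw: "c = z \<or> E' c z" "z = w \<or> E' z w" "w = v \<or> E' w v"
    using near by (auto simp: reach_3)
  show ?thesis
  proof (cases "w = v")
    case True
    then have "E' c z" "E' z v" using zw cv by auto
    then show ?thesis using cv uv F irrefl
      by (intro exI[of _ z]) (metis insertE singletonD)
  next
    case False
    then have w: "E' w v" using zw by auto
    then have "w \<noteq> u" "w \<noteq> c" using uv cv by auto
    moreover have "z \<noteq> u" using zw w uv by auto
    moreover have "z \<noteq> v" using zw cv by auto
    moreover have "E v w" using F w by blast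
    ultimately show ?thesis using zw F(1) False
      by (intro exI[of _ z] exI[of _ w]) auto
  qed
qed

lemma separable_if_deletion:
  assumes F: "finite F" "\<And>x y. x \<in> V \<Longrightarrow> y \<in> V \<Longrightarrow> reach (\<lambda>x y. E x y \<and> {x, y} \<notin> F) 3 x y"
    and uv: "u \<in> V" "v \<in> V" "\<not> reach (\<lambda>x y. E x y \<and> {x, y} \<notin> F) 2 u v"
  shows "separable E u v" "sep_cost E u v \<le> card F"
proof -
  define E' where "E' = (\<lambda>x y. E x y \<and> {x, y} \<notin> F)"
  have E': "\<And>x y. E' x y \<Longrightarrow> E x y" "\<And>x y. E' x y \<Longrightarrow> E' y x"
    unfolding E'_def using sym by (auto simp: insert_commute)
  have n3: "\<And>x y. x \<in> V \<Longrightarrow> y \<in> V \<Longrightarrow> reach E' 3 x y" and far: "\<not> reach E' 2 u v"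
    using F(2) uv(3) unfolding E'_def by auto
  have far': "\<not> reach E' 2 v u" using far E'(2) by (auto simp: reach_2)
  have ne: "u \<noteq> v" using far by (auto simp: reach_refl)
  have cut: "\<not> E' u c \<or> \<not> E' v c" for c
    using far E'(2) by (auto simp: reach_2_cases)
  have "\<exists>z w. z \<notin> {u, v} \<and> w \<notin> {u, v, c} \<and> (E u w \<or> E v w) \<and> (c = z \<or> E c z) \<and> (z = w \<or> E z w)"
    if c: "E u c" "E v c" for c
  proof -
    have cV: "c \<in> V" using c in_V sym by blast
    from cut[of c] show ?thesis
    proof
      assume "\<not> E' v c"
      then show ?thesis using separable_detour[OF E' far n3[OF cV uv(2)]] c by auto
    next
      assume "\<not> E' u c"
      then show ?thesis using separable_detour[OF E' far' n3[OF cV uv(1)]] c by fast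
    qed
  qed
  \<comment> \<open>At distance exactly 3 this walk cannot stutter, so its middle edge is the
    required edge \<open>st\<close>.\<close>
  moreover obtain s t where st: "u = s \<or> E' u s" "s = t \<or> E' s t" "t = v \<or> E' t v"
    using n3[OF uv(1,2)] by (auto simp: reach_3)
  have "E' u s \<and> E' s t \<and> E' t v \<and> s \<noteq> v \<and> t \<noteq> u"
    using st far by (auto simp: reach_2)
  then have "E u s \<and> s \<noteq> v \<and> E v t \<and> t \<noteq> u \<and> E s t" using E' by blast
  ultimately show "separable E u v" using ne unfolding separable_def by blast
  let ?C = "{c. E u c \<and> E v c}"
  \<comment> \<open>Every common neighbour loses an edge to \<open>u\<close> or to \<open>v\<close>,
    and \<open>f\<close> charges one such edge. Distinct common neighbours are charged distinct
    edges, none of them \<open>{u, v}\<close>, which is counted separately.\<close>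
  define f where "f c = (if {u, c} \<in> F then {u, c} else {v, c})" for c
  have cF: "f c \<in> F - {{u, v}}" if "c \<in> ?C" for c
    using that cut[of c] irrefl unfolding f_def E'_def by (auto simp: doubleton_eq_iff)
  have "inj_on f ?C" using irrefl ne
    unfolding f_def inj_on_def by (auto simp: doubleton_eq_iff split: if_splits)
  then have "card ?C \<le> card (F - {{u, v}})"
    using cF F(1) by (intro card_inj_on_le[of f]) auto
  moreover have "E u v \<Longrightarrow> {u, v} \<in> F" using far by (auto simp: reach_2 E'_def)
  moreover have "{u, v} \<in> F \<Longrightarrow> Suc (card (F - {{u, v}})) = card F"
    using F(1) by (rule card_Suc_Diff1)
  moreover have "card (F - {{u, v}}) \<le> card F" using F(1) by (intro card_mono) auto
  ultimately show "sep_cost E u v \<le> card F" unfolding sep_cost_def by (auto simp: of_bool_def)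
qed

end


section \<open>Deletions given by a 2-colouring\<close>

text \<open>\<open>g\<close> holds for the neighbours that stay attached to \<open>u\<close> and
  fails for those that stay attached to \<open>v\<close>. The last two assumptions are guards: if
  \<open>u\<close> has no private neighbour, each private neighbour of \<open>v\<close> must be
  adjacent to a neighbour of \<open>u\<close> other than \<open>v\<close>, and likewise with
  \<open>u\<close> and \<open>v\<close> exchanged.\<close>

locale splitting = diameter_2 V E for V :: "'a set" and E +
  fixes u v :: 'a and g :: "'a \<Rightarrow> bool"
  assumes uv: "u \<in> V" "v \<in> V" "u \<noteq> v"
    and only_u: "E u x \<Longrightarrow> \<not> E v x \<Longrightarrow> x \<noteq> v \<Longrightarrow> g x"
    and only_v: "E v x \<Longrightarrow> \<not> E u x \<Longrightarrow> x \<noteq> u \<Longrightarrow> \<not> g x"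
    and cross_edge: "\<exists>s t. E u s \<and> s \<noteq> v \<and> g s \<and> E v t \<and> t \<noteq> u \<and> \<not> g t \<and> E s t"
    and opposite: "E u c \<Longrightarrow> E v c \<Longrightarrow>
      (\<exists>w. w \<notin> {u, v} \<and> (E u w \<or> E v w) \<and> E c w \<and> g w \<noteq> g c) \<or>
      (\<forall>w. E c w \<and> w \<notin> {u, v} \<longrightarrow> \<not> E u w \<and> \<not> E v w) \<and>
      (\<exists>w z. w \<notin> {u, v} \<and> z \<notin> {u, v} \<and> (E u w \<or> E v w) \<and> (c = z \<or> E c z) \<and> (z = w \<or> E z w) \<and> g w \<noteq> g c)"
    and only_u_or: "(\<exists>x. E u x \<and> \<not> E v x \<and> x \<noteq> v) \<or> (\<forall>x. E v x \<and> \<not> E u x \<and> x \<noteq> u \<longrightarrow> (\<exists>y. E x y \<and> E u y \<and> y \<noteq> v))"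
    and only_v_or: "(\<exists>x. E v x \<and> \<not> E u x \<and> x \<noteq> u) \<or> (\<forall>x. E u x \<and> \<not> E v x \<and> x \<noteq> v \<longrightarrow> (\<exists>y. E x y \<and> E v y \<and> y \<noteq> u))"
begin

text \<open>Exchanging \<open>u\<close> with \<open>v\<close> and negating the colours is a
  symmetry, so each fact proved about \<open>u\<close> transfers to \<open>v\<close>.\<close>

lemma swap: "splitting V E v u (\<lambda>x. \<not> g x)"
proof
  show "\<exists>s t. E v s \<and> s \<noteq> u \<and> \<not> g s \<and> E u t \<and> t \<noteq> v \<and> \<not> \<not> g t \<and> E s t"
    using cross_edge sym by blast
next
  fix c assume "E v c" "E u c"
  then show "(\<exists>w. w \<notin> {v, u} \<and> (E v w \<or> E u w) \<and> E c w \<and> (\<not> g w) \<noteq> (\<not> g c)) \<or>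
      (\<forall>w. E c w \<and> w \<notin> {v, u} \<longrightarrow> \<not> E v w \<and> \<not> E u w) \<and>
      (\<exists>w z. w \<notin> {v, u} \<and> z \<notin> {v, u} \<and> (E v w \<or> E u w) \<and> (c = z \<or> E c z) \<and> (z = w \<or> E z w) \<and> (\<not> g w) \<noteq> (\<not> g c))"
    using opposite[of c] by (simp add: insert_commute disj_commute conj_commute)
qed (use uv only_u only_v only_u_or only_v_or in auto)

definition kept :: "'a \<Rightarrow> 'a \<Rightarrow> bool" where
  "kept x y \<longleftrightarrow> E x y \<and> (x = u \<longrightarrow> y \<noteq> v \<and> g y) \<and> (y = u \<longrightarrow> x \<noteq> v \<and> g x) \<and>
     (x = v \<longrightarrow> y \<noteq> u \<and> \<not> g y) \<and> (y = v \<longrightarrow> x \<noteq> u \<and> \<not> g x)"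

text \<open>Between vertices other than \<open>u\<close> and \<open>v\<close>, such a walk is
  untouched by the deletion, which removes only edges at \<open>u\<close> or
  \<open>v\<close>.\<close>

definition close :: "'a \<Rightarrow> 'a \<Rightarrow> bool" where
  "close x y \<longleftrightarrow> (\<exists>z. z \<notin> {u, v} \<and> (x = z \<or> E x z) \<and> (z = y \<or> E z y))"

lemma kept_sym: "kept x y \<Longrightarrow> kept y x"
  using sym unfolding kept_def by blast

lemma reach_kept_3_sym: "reach kept 3 x y \<Longrightarrow> reach kept 3 y x"
  using kept_sym unfolding reach_3 by metis

lemma kept_u: "kept u x \<longleftrightarrow> E u x \<and> x \<noteq> v \<and> g x"
  using uv irrefl unfolding kept_def by blast

lemma kept_v: "kept v x \<longleftrightarrow> E v x \<and> x \<noteq> u \<and> \<not> g x"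
  using uv irrefl unfolding kept_def by blast

lemma kept_off: "x \<notin> {u, v} \<Longrightarrow> y \<notin> {u, v} \<Longrightarrow> kept x y \<longleftrightarrow> E x y"
  unfolding kept_def by auto

lemma close_nonneighbour:
  assumes "x \<in> V" "y \<in> V" "x \<notin> {u, v}" "y \<notin> {u, v}" "\<not> E u x" "\<not> E v x"
  shows "close x y"
  using dist_2[OF assms(1,2)]
proof (elim disjE exE conjE)
  fix z assume z: "E x z" "E z y"
  then have "z \<notin> {u, v}" using assms(5,6) sym by blast
  then show ?thesis using z unfolding close_def by blast
qed (use assms(3,4) in \<open>auto simp: close_def\<close>)

lemma close_imp_kept:
  assumes "close x y" "x \<notin> {u, v}" "y \<notin> {u, v}"
  obtains z where "x = z \<or> kept x z" "z = y \<or> kept z y"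
  using assms kept_off unfolding close_def by blast

lemma opposite_close:
  assumes "E u c" "E v c"
  shows "\<exists>w. w \<notin> {u, v} \<and> (E u w \<or> E v w) \<and> close c w \<and> g w \<noteq> g c"
  using opposite[OF assms] unfolding close_def by blast

text \<open>One more step leads from \<open>s\<close> to \<open>u\<close>, so this keeps every
  vertex within distance 3 of \<open>u\<close>. The private neighbours of \<open>v\<close> are the
  hard case, and the one that needs \<open>only_u_or\<close>.\<close>

lemma close_to_u_side:
  assumes x: "x \<in> V" "x \<notin> {u, v}"
  shows "\<exists>s. kept u s \<and> close x s"
proof -
  obtain s where s: "kept u s" using cross_edge by (auto simp: kept_u)
  then have sV: "s \<in> V" "s \<notin> {u, v}" using irrefl in_V sym by (auto simp: kept_u) blast+
  consider "\<not> E u x" "\<not> E v x" | "E u x" "g x" | "E u x" "E v x" "\<not> g x" | "\<not> E u x" "E v x"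
    using only_u x by blast
  then show ?thesis
  proof cases
    case 1
    then show ?thesis using close_nonneighbour[of x s] s sV x by auto
  next
    case 2
    then show ?thesis using x by (intro exI[of _ x]) (auto simp: kept_u close_def)
  next
    case 3
    \<comment> \<open>The vertex of the other colour satisfies \<open>g\<close>, so it is not
      private to \<open>v\<close> and stays attached to \<open>u\<close>.\<close>
    then show ?thesis using opposite_close[of x] only_v by (auto simp: kept_u)
  next
    case 4
    show ?thesis
    proof (cases "\<exists>y. E u y \<and> \<not> E v y \<and> y \<noteq> v")
      case True
      then obtain y where y: "E u y" "\<not> E v y" "y \<noteq> v" by auto
      then have "y \<in> V" "y \<noteq> u" using in_V sym irrefl by blast+
      \<comment> \<open>The middle vertex is neither \<open>u\<close>, which is not adjacent to
        \<open>x\<close>, nor \<open>v\<close>, which is not adjacent to \<open>y\<close>.\<close>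
      have "close x y"
        using dist_2[OF x(1) \<open>y \<in> V\<close>]
      proof (elim disjE exE conjE)
        fix z assume z: "E x z" "E z y"
        then have "z \<noteq> u" "z \<noteq> v" using 4(1) y(2) sym by blast+
        then show ?thesis using z unfolding close_def by blast
      qed (use x y \<open>y \<noteq> u\<close> in \<open>auto simp: close_def\<close>)
      then show ?thesis using y only_u by (auto simp: kept_u)
    next
      case False
      then obtain y where y: "E x y" "E u y" "y \<noteq> v" using only_u_or 4 x by auto
      with False have vy: "E v y" by blast
      have yu: "y \<noteq> u" using y irrefl by auto
      show ?thesis
      proof (cases "g y")
        case True
        then show ?thesis using y yu by (intro exI[of _ y]) (auto simp: kept_u close_def)
      next
        case gy: False
        have "E y x" using y sym by blast
        \<comment> \<open>As \<open>x\<close> is a neighbour of both \<open>y\<close> and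
          \<open>v\<close>, the second alternative of \<open>opposite\<close> is ruled out for
          \<open>y\<close>.\<close>
        then obtain w where w: "w \<notin> {u, v}" "E u w \<or> E v w" "E y w" "g w"
          using opposite[OF y(2) vy] gy 4 x by blast
        then have "kept u w" using only_v by (auto simp: kept_u)
        moreover have "close x w" using y yu w by (auto simp: close_def)
        ultimately show ?thesis by blast
      qed
    qed
  qed
qed


lemma reach_u:
  assumes "x \<in> V"
  shows "reach kept 3 u x"
proof -
  consider "x = u" | "x = v" | "x \<notin> {u, v}" by blast
  then show ?thesis
  proof cases
    case 2
    obtain s t where st: "kept u s" "kept v t" "E s t" "s \<noteq> v" "t \<noteq> u"
      using cross_edge by (auto simp: kept_u kept_v)
    then have "kept s t" using irrefl by (intro kept_off[THEN iffD2]) (auto simp: kept_u kept_v)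
    then show ?thesis using st 2 kept_sym unfolding reach_3 by blast
  next
    case 3
    then obtain s where s: "kept u s" "close x s" using close_to_u_side assms by blast
    then have "s \<notin> {u, v}" using irrefl by (auto simp: kept_u)
    with s(2) 3 obtain z where "x = z \<or> kept x z" "z = s \<or> kept z s" by (rule close_imp_kept)
    then show ?thesis using s(1) kept_sym unfolding reach_3 by metis
  qed (simp add: reach_refl)
qed

text \<open>The hard case is \<open>y\<close> attached to \<open>v\<close>. Either \<open>y\<close>
  has a neighbour \<open>w\<close> attached to \<open>u\<close>, giving \<open>x, u, w, y\<close>,
  or it has a neighbour \<open>r\<close> adjacent to neither \<open>u\<close> nor \<open>v\<close>,
  and \<open>r\<close> is \<open>close\<close> to \<open>x\<close>.\<close>

lemma reach_through_u:
  assumes "x \<notin> {u, v}" "y \<notin> {u, v}" "E u x" "E u y" "g x"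
  shows "reach kept 3 x y"
proof (cases "g y")
  case True
  then have "kept x u" "kept u y" using assms kept_sym by (auto simp: kept_u)
  then show ?thesis unfolding reach_3 by blast
next
  case False
  have xV: "x \<in> V" "y \<in> V" using assms in_V sym by blast+
  have xu: "kept x u" using assms kept_sym by (auto simp: kept_u)
  have vy: "E v y" using only_u False assms by blast
  from opposite[OF assms(4) vy] show ?thesis
  proof
    assume "\<exists>w. w \<notin> {u, v} \<and> (E u w \<or> E v w) \<and> E y w \<and> g w \<noteq> g y"
    then obtain w where w: "w \<notin> {u, v}" "E u w \<or> E v w" "E y w" "g w" using False by auto
    then have "kept u w" "kept w y" using only_v kept_off assms sym by (auto simp: kept_u)
    with xu show ?thesis unfolding reach_3 by blast
  next
    assume iso: "(\<forall>w. E y w \<and> w \<notin> {u, v} \<longrightarrow> \<not> E u w \<and> \<not> E v w) \<and>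
      (\<exists>w z. w \<notin> {u, v} \<and> z \<notin> {u, v} \<and> (E u w \<or> E v w) \<and> (y = z \<or> E y z) \<and> (z = w \<or> E z w) \<and> g w \<noteq> g y)"
    \<comment> \<open>This is the first step from \<open>y\<close> towards a vertex of the other
      colour: since no neighbour of \<open>y\<close> other than \<open>u\<close> and
      \<open>v\<close> is adjacent to \<open>u\<close> or \<open>v\<close>, that step leads outside
      both neighbourhoods.\<close>
    then obtain r where r: "r \<notin> {u, v}" "E y r" "\<not> E u r" "\<not> E v r" by metis
    have "close r x" using r xV assms in_V sym by (intro close_nonneighbour) blast+
    then obtain z where "r = z \<or> kept r z" "z = x \<or> kept z x"
      using r assms by (elim close_imp_kept) auto
    moreover have "kept y r" using kept_off r assms by blast
    ultimately have "reach kept 3 y x" unfolding reach_3 by blast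
    then show ?thesis by (rule reach_kept_3_sym)
  qed
qed

interpretation swap: splitting V E v u "\<lambda>x. \<not> g x" by (rule swap)

lemma kept_swap: "swap.kept = kept"
  unfolding kept_def swap.kept_def by (intro ext) auto

lemma reach_kept_3:
  assumes xV: "x \<in> V" "y \<in> V"
  shows "reach kept 3 x y"
proof (cases "x \<in> {u, v} \<or> y \<in> {u, v}")
  case True
  then show ?thesis
    using xV reach_u swap.reach_u reach_kept_3_sym unfolding kept_swap by blast
next
  case False
  then have off: "x \<notin> {u, v}" "y \<notin> {u, v}" by auto
  \<comment> \<open>If neither vertex is attached to \<open>u\<close>, both are common neighbours,
    and the mirrored lemma routes them through \<open>v\<close>.\<close>
  have side: "reach kept 3 x y" if "E u x" "E u y" "x \<notin> {u, v}" "y \<notin> {u, v}" for x y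
  proof -
    consider "g x" | "g y" | "\<not> g x" "\<not> g y" by blast
    then show ?thesis
    proof cases
      case 3
      then have "E v x" "E v y" using that only_u by blast+
      then show ?thesis using swap.reach_through_u[of x y] that 3 unfolding kept_swap by blast
    qed (use that reach_through_u[of x y] reach_through_u[of y x] reach_kept_3_sym in blast)+
  qed
  have side': "reach kept 3 x y" if "E v x" "E v y" "x \<notin> {u, v}" "y \<notin> {u, v}" for x y
  proof -
    consider "g x" "g y" | "\<not> g x" | "\<not> g y" by blast
    then show ?thesis
    proof cases
      case 1
      then have "E u x" "E u y" using that only_v by blast+
      then show ?thesis using side that by blast
    qed (use that swap.reach_through_u[of x y] swap.reach_through_u[of y x] reach_kept_3_sym
      in \<open>unfold kept_swap, blast\<close>)+
  qed
  from dist_2[OF xV] consider "x = y" | "E x y" | z where "E x z" "E z y" by blast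
  then show ?thesis
  proof cases
    case 1
    then show ?thesis by (simp add: reach_refl)
  next
    case 2
    then show ?thesis using kept_off[OF off] unfolding reach_3 by blast
  next
    case (3 z)
    then show ?thesis
      using side[of x y] side'[of x y] off sym kept_off[of x z] kept_off[of z y]
      unfolding reach_3 by (cases "z \<in> {u, v}") blast+
  qed
qed

lemma not_reach_kept_2: "\<not> reach kept 2 u v"
  using uv kept_u kept_v kept_sym unfolding reach_2_cases by blast

text \<open>A common neighbour loses only the edge rejected by its colour, and private neighbours
  lose none at \<open>u\<close> or \<open>v\<close>; the edge \<open>uv\<close> accounts for the
  remaining term.\<close>

lemma deletion_cost: "card {{x, y} | x y. E x y \<and> \<not> kept x y} \<le> sep_cost E u v"
proof -
  let ?C = "{c. E u c \<and> E v c}"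
  let ?h = "\<lambda>c. if g c then {v, c} else {u, c}"
  let ?e = "if E u v then {{u, v}} else {}"
  have "{{x, y} | x y. E x y \<and> \<not> kept x y} \<subseteq> ?h ` ?C \<union> ?e"
  proof safe
    fix x y assume xy: "E x y" "\<not> kept x y" "{x, y} \<notin> ?e"
    then have yx: "E y x" using sym by blast
    have nuv: "{x, y} \<noteq> {u, v}" using xy yx by (auto simp: doubleton_eq_iff split: if_splits)
    have *: "{u, c} \<in> ?h ` ?C" if "E u c" "c \<noteq> v" "\<not> g c" for c
      using that only_u[of c] by (intro image_eqI[of _ _ c]) auto
    have **: "{v, c} \<in> ?h ` ?C" if "E v c" "c \<noteq> u" "g c" for c
      using that only_v[of c] by (intro image_eqI[of _ _ c]) auto
    from xy(1,2) nuv consider "x = u" "y \<noteq> v" "\<not> g y" | "y = u" "x \<noteq> v" "\<not> g x"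
      | "x = v" "y \<noteq> u" "g y" | "y = v" "x \<noteq> u" "g x"
      unfolding kept_def by auto
    then show "{x, y} \<in> ?h ` ?C"
      using *[of x] *[of y] **[of x] **[of y] xy(1) yx by cases (simp_all add: insert_commute)
  qed
  moreover have "finite (?h ` ?C \<union> ?e)" using finite_nbrs by auto
  ultimately have "card {{x, y} | x y. E x y \<and> \<not> kept x y} \<le> card (?h ` ?C \<union> ?e)"
    by (intro card_mono)
  also have "\<dots> \<le> card (?h ` ?C) + card ?e" by (rule card_Un_le)
  also have "\<dots> \<le> card ?C + of_bool (E u v)"
    using card_image_le[OF finite_nbrs, of ?h u v] by auto
  finally show ?thesis by (simp add: sep_cost_def)
qed

end



section \<open>Existence of a suitable colouring\<close>

context diameter_2
begin

text \<open>With the private neighbours \<open>A\<close> and \<open>B\<close> fixed,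
  \<open>opposite_colouring\<close> is applied twice. \<open>C1\<close>, the common neighbours with
  a neighbour in \<open>W\<close>, comes first with adjacency as \<open>P\<close>. The rest,
  \<open>C2\<close>, only needs the weaker relation \<open>P\<close> and may refer to colours from
  the first round.\<close>

lemma ex_splitting:
  assumes uv: "u \<in> V" "v \<in> V" "separable E u v"
    and only_u_or: "(\<exists>x. E u x \<and> \<not> E v x \<and> x \<noteq> v) \<or> (\<forall>x. E v x \<and> \<not> E u x \<and> x \<noteq> u \<longrightarrow> (\<exists>y. E x y \<and> E u y \<and> y \<noteq> v))"
    and only_v_or: "(\<exists>x. E v x \<and> \<not> E u x \<and> x \<noteq> u) \<or> (\<forall>x. E u x \<and> \<not> E v x \<and> x \<noteq> v \<longrightarrow> (\<exists>y. E x y \<and> E v y \<and> y \<noteq> u))"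
  shows "\<exists>g. splitting V E u v g"
proof -
  define A where "A = {x. E u x \<and> \<not> E v x \<and> x \<noteq> v}"
  define B where "B = {x. E v x \<and> \<not> E u x \<and> x \<noteq> u}"
  define C where "C = {c. E u c \<and> E v c}"
  define W where "W = {w. w \<notin> {u, v} \<and> (E u w \<or> E v w)}"
  define P where "P x y \<longleftrightarrow> (\<exists>z. z \<notin> {u, v} \<and> (x = z \<or> E x z) \<and> (z = y \<or> E z y))" for x y
  define C1 where "C1 = {c \<in> C. \<exists>w\<in>W. E c w}"
  define C2 where "C2 = C - C1"
  have W: "W = A \<union> B \<union> C" unfolding W_def A_def B_def C_def using irrefl by auto
  have disj: "A \<inter> B = {}" "C \<inter> (A \<union> B) = {}" unfolding A_def B_def C_def by auto
  have fin_C: "finite C" unfolding C_def by (rule finite_nbrs)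
  have C1: "\<exists>w\<in>C1 \<union> (A \<union> B). w \<noteq> c \<and> E c w" if c: "c \<in> C1" for c
  proof -
    obtain w where w: "w \<in> W" "E c w" using c by (auto simp: C1_def)
    have "c \<in> W" using c W by (auto simp: C1_def)
    \<comment> \<open>By symmetry of \<open>E\<close>, a common neighbour adjacent to
      \<open>c\<close> is itself in \<open>C1\<close>, so the first round never refers to a vertex
      of \<open>C2\<close>.\<close>
    then have "w \<in> C \<Longrightarrow> w \<in> C1" using w sym unfolding C1_def by blast
    then show ?thesis using w irrefl W by (intro bexI[of _ w]) auto
  qed
  have "finite C1" "C1 \<inter> (A \<union> B) = {}" using fin_C disj unfolding C1_def by auto
  from opposite_colouring[OF this sym C1, of "\<lambda>x. x \<in> A"]
  obtain h where h: "\<forall>x\<in>A \<union> B. h x = (x \<in> A)" "\<forall>c\<in>C1. \<exists>w\<in>C1 \<union> (A \<union> B). E c w \<and> h w \<noteq> h c"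
    by blast
  have C2: "\<exists>w\<in>C2 \<union> (A \<union> B \<union> C1). w \<noteq> c \<and> P c w" if c: "c \<in> C2" for c
  proof -
    have "E u c \<and> E v c" using c by (simp add: C2_def C_def)
    then obtain z w where "z \<notin> {u, v}" "w \<notin> {u, v, c}" "E u w \<or> E v w" "c = z \<or> E c z" "z = w \<or> E z w"
      using uv(3) unfolding separable_def by blast
    then have "w \<in> W" "P c w" "w \<noteq> c" by (auto simp: W_def P_def)
    moreover have "W = C2 \<union> (A \<union> B \<union> C1)" unfolding W C2_def by (auto simp: C1_def)
    ultimately show ?thesis by auto
  qed
  have P_sym: "P x y \<Longrightarrow> P y x" for x y using sym unfolding P_def by blast
  have "finite C2" "C2 \<inter> (A \<union> B \<union> C1) = {}" using fin_C disj unfolding C2_def by auto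
  from opposite_colouring[OF this P_sym C2, of h]
  obtain g where g: "\<forall>x\<in>A \<union> B \<union> C1. g x = h x"
      "\<forall>c\<in>C2. \<exists>w\<in>C2 \<union> (A \<union> B \<union> C1). P c w \<and> g w \<noteq> g c"
    by blast
  have gA: "g x" if "x \<in> A" for x using that g(1) h(1) by auto
  have gB: "\<not> g x" if "x \<in> B" for x using that g(1) h(1) disj by auto
  have gC1: "\<exists>w\<in>W. E c w \<and> g w \<noteq> g c" if c: "c \<in> C1" for c
  proof -
    obtain w where "w \<in> C1 \<union> (A \<union> B)" "E c w" "h w \<noteq> h c" using h(2) c by blast
    then show ?thesis using g(1) c W by (intro bexI[of _ w]) (auto simp: C1_def)
  qed
  have "splitting V E u v g"
  proof
    show "u \<in> V" "v \<in> V" "u \<noteq> v" using uv by (auto simp: separable_def)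
    show "E u x \<Longrightarrow> \<not> E v x \<Longrightarrow> x \<noteq> v \<Longrightarrow> g x" for x using gA by (simp add: A_def)
    show "E v x \<Longrightarrow> \<not> E u x \<Longrightarrow> x \<noteq> u \<Longrightarrow> \<not> g x" for x using gB by (simp add: B_def)
    show "\<exists>s t. E u s \<and> s \<noteq> v \<and> g s \<and> E v t \<and> t \<noteq> u \<and> \<not> g t \<and> E s t"
    \<comment> \<open>If \<open>C1\<close> is empty, both ends of the edge provided by
      \<open>separable\<close> are private and hence coloured as needed. Otherwise any
      \<open>c\<close> in \<open>C1\<close> and an oppositely coloured neighbour of it form the
      edge.\<close>
    proof (cases "C1 = {}")
      case True
      obtain s t where st: "E u s" "s \<noteq> v" "E v t" "t \<noteq> u" "E s t"
        using uv(3) unfolding separable_def by auto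
      then have "s \<in> W" "t \<in> W" unfolding W_def using irrefl by auto
      with True st sym have "s \<notin> C" "t \<notin> C" unfolding C1_def by blast+
      then have "s \<in> A" "t \<in> B" using st by (auto simp: A_def B_def C_def)
      then show ?thesis using st gA gB by blast
    next
      case False
      then obtain c where c: "c \<in> C1" by auto
      then obtain w where w: "w \<in> W" "E c w" "g w \<noteq> g c" using gC1 by blast
      have cC: "E u c" "E v c" "c \<noteq> u" "c \<noteq> v" using c irrefl unfolding C1_def C_def by auto
      show ?thesis
      proof (cases "g c")
        case True
        then have "w \<notin> A" using w gA by auto
        then have "E v w" "w \<noteq> u" using w(1) unfolding A_def W_def by auto
        then show ?thesis using cC w True by blast
      next
        case False
        then have "w \<notin> B" using w gB by auto
        then have "E u w" "w \<noteq> v" using w(1) unfolding B_def W_def by auto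
        then show ?thesis using cC w False sym by blast
      qed
    qed
    fix c assume "E u c" "E v c"
    then have cC: "c \<in> C" by (simp add: C_def)
    show "(\<exists>w. w \<notin> {u, v} \<and> (E u w \<or> E v w) \<and> E c w \<and> g w \<noteq> g c) \<or>
      (\<forall>w. E c w \<and> w \<notin> {u, v} \<longrightarrow> \<not> E u w \<and> \<not> E v w) \<and>
      (\<exists>w z. w \<notin> {u, v} \<and> z \<notin> {u, v} \<and> (E u w \<or> E v w) \<and> (c = z \<or> E c z) \<and> (z = w \<or> E z w) \<and> g w \<noteq> g c)"
    proof (cases "c \<in> C1")
      case True
      then show ?thesis using gC1[OF True] unfolding W_def by blast
    next
      case False
      then have "c \<in> C2" using cC by (simp add: C2_def)
      then obtain w where w: "w \<in> C2 \<union> (A \<union> B \<union> C1)" "P c w" "g w \<noteq> g c" using g(2) by blast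
      then have "w \<in> W" unfolding W C2_def C1_def by auto
      moreover have "\<forall>w. E c w \<and> w \<notin> {u, v} \<longrightarrow> \<not> E u w \<and> \<not> E v w"
        using False cC unfolding C1_def W_def by blast
      ultimately show ?thesis using w unfolding W_def P_def by blast
    qed
  qed (use only_u_or only_v_or in auto)
  then show ?thesis by blast
qed

text \<open>Both guards hold by their second alternatives: a private neighbour of \<open>v\<close>
  has a common neighbour with \<open>u\<close> by \<open>dist_2\<close>, and this is not
  \<open>v\<close>, since \<open>v\<close> is not adjacent to \<open>u\<close>.\<close>

lemma ex_splitting_if_nonadjacent:
  assumes "u \<in> V" "v \<in> V" "separable E u v" "\<not> E u v"
  shows "\<exists>g. splitting V E u v g"
proof (rule ex_splitting[OF assms(1-3)]; intro disjI2 allI impI)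
  fix x
  show "\<exists>y. E x y \<and> E u y \<and> y \<noteq> v" if "E v x \<and> \<not> E u x \<and> x \<noteq> u"
    using that dist_2[of x u] in_V sym assms by metis
  show "\<exists>y. E x y \<and> E v y \<and> y \<noteq> u" if "E u x \<and> \<not> E v x \<and> x \<noteq> v"
    using that dist_2[of x v] in_V sym assms by metis
qed

text \<open>If \<open>u\<close> has no private neighbour while some private neighbour \<open>x\<close> of \<open>v\<close> has no neighbour in
  common with \<open>u\<close> besides \<open>v\<close>, then no splitting of \<open>u, v\<close> need exist, but \<open>v\<close> is the only common
  neighbour of the non-adjacent vertices \<open>u\<close> and \<open>x\<close>, so that this pair is as cheap as possible.\<close>

lemma cheap_splitting:
  assumes uv: "separable E u v" "E u v"
    and no_only_u: "\<not> (\<exists>x. E u x \<and> \<not> E v x \<and> x \<noteq> v)"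
    and x: "E v x" "\<not> E u x" "x \<noteq> u" "\<not> (\<exists>y. E x y \<and> E u y \<and> y \<noteq> v)"
  shows "\<exists>g. splitting V E u x g" "sep_cost E u x = 1"
proof -
  have common: "E u c \<and> E x c \<longleftrightarrow> c = v" for c using x uv sym by blast
  then show "sep_cost E u x = 1" using x by (simp add: sep_cost_def)
  \<comment> \<open>Having no private neighbour, \<open>u\<close> shares \<open>s\<close> with
    \<open>v\<close>. For the new pair \<open>u, x\<close>, this \<open>s\<close> provides both the
    detour for \<open>v\<close> and the edge \<open>sv\<close> between the neighbourhoods.\<close>
  obtain s where s: "E u s" "s \<noteq> v" using uv unfolding separable_def by auto
  have vs: "E v s" using no_only_u s by blast
  have ne: "s \<noteq> u" "s \<noteq> x" "v \<noteq> u" "v \<noteq> x" using s uv(2) x irrefl by auto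
  have "separable E u x"
    unfolding separable_def
  proof (intro conjI allI impI)
    fix c assume "E u c \<and> E x c"
    then have c: "c = v" using common by blast
    show "\<exists>z w. z \<notin> {u, x} \<and> w \<notin> {u, x, c} \<and> (E u w \<or> E x w) \<and> (c = z \<or> E c z) \<and> (z = w \<or> E z w)"
      using s vs ne unfolding c by (intro exI[of _ v] exI[of _ s]) auto
  next
    show "\<exists>s t. E u s \<and> s \<noteq> x \<and> E x t \<and> t \<noteq> u \<and> E s t"
      using s vs ne x sym by blast
  qed (use x in auto)
  then show "\<exists>g. splitting V E u x g"
    using x uv in_V sym by (intro ex_splitting_if_nonadjacent) blast+
qed

lemma separable_commute: "separable E u v \<Longrightarrow> separable E v u"
  unfolding separable_def using sym by (simp add: insert_commute disj_commute conj_commute) blast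

text \<open>The given pair may have to be replaced by one of cost 1, which \<open>0 < k\<close>
  makes affordable.\<close>

lemma ex_cheap_splitting:
  assumes uv: "u \<in> V" "v \<in> V" "separable E u v" and k: "sep_cost E u v \<le> k" "0 < k"
  shows "\<exists>u v g. splitting V E u v g \<and> sep_cost E u v \<le> k"
proof (cases "E u v")
  case False
  then show ?thesis using ex_splitting_if_nonadjacent uv k by blast
next
  case adj: True
  show ?thesis
  proof (cases "(\<exists>x. E u x \<and> \<not> E v x \<and> x \<noteq> v) \<or> (\<forall>x. E v x \<and> \<not> E u x \<and> x \<noteq> u \<longrightarrow> (\<exists>y. E x y \<and> E u y \<and> y \<noteq> v))")
    case False
    then obtain x g where "splitting V E u x g" "sep_cost E u x = 1"
      using cheap_splitting[OF uv(3) adj] by metis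
    then show ?thesis using k(2) by (intro exI[of _ u] exI[of _ x] exI[of _ g]) auto
  next
    case u: True
    show ?thesis
    proof (cases "(\<exists>x. E v x \<and> \<not> E u x \<and> x \<noteq> u) \<or> (\<forall>x. E u x \<and> \<not> E v x \<and> x \<noteq> v \<longrightarrow> (\<exists>y. E x y \<and> E v y \<and> y \<noteq> u))")
      case False
      then obtain x g where "splitting V E v x g" "sep_cost E v x = 1"
        using cheap_splitting[OF separable_commute[OF uv(3)] sym[OF adj]] by metis
      then show ?thesis using k(2) by (intro exI[of _ v] exI[of _ x] exI[of _ g]) auto
    next
      case True
      then show ?thesis using ex_splitting[OF uv u] k by blast
    qed
  qed
qed

theorem deletion_iff_separable:
  assumes "0 < k"
  shows "(\<exists>F\<subseteq>{{x, y} | x y. E x y}. card F \<le> k \<and>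
      (\<forall>x\<in>V. \<forall>y\<in>V. reach (\<lambda>x y. E x y \<and> {x, y} \<notin> F) 3 x y) \<and>
      (\<exists>u\<in>V. \<exists>v\<in>V. \<not> reach (\<lambda>x y. E x y \<and> {x, y} \<notin> F) 2 u v)) \<longleftrightarrow>
    (\<exists>u\<in>V. \<exists>v\<in>V. separable E u v \<and> sep_cost E u v \<le> k)"
    (is "?lhs \<longleftrightarrow> ?rhs")
proof
  assume ?lhs
  then obtain F u v where F: "F \<subseteq> {{x, y} | x y. E x y}" "card F \<le> k"
    "\<And>x y. x \<in> V \<Longrightarrow> y \<in> V \<Longrightarrow> reach (\<lambda>x y. E x y \<and> {x, y} \<notin> F) 3 x y"
    "u \<in> V" "v \<in> V" "\<not> reach (\<lambda>x y. E x y \<and> {x, y} \<notin> F) 2 u v" by blast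
  \<comment> \<open>Finiteness matters because \<open>card\<close> is 0 on infinite sets.\<close>
  have "F \<subseteq> Pow V" using F(1) in_V sym by blast
  then have "finite F" using fin finite_subset by blast
  then show ?rhs using separable_if_deletion[of F u v] F le_trans by blast
next
  assume ?rhs
  then obtain u v g where "splitting V E u v g" and cost: "sep_cost E u v \<le> k"
    using ex_cheap_splitting assms by blast
  then interpret splitting V E u v g by simp
  let ?F = "{{x, y} | x y. E x y \<and> \<not> kept x y}"
  have "(\<lambda>x y. E x y \<and> {x, y} \<notin> ?F) = kept"
  proof (intro ext iffI)
    fix x y assume "kept x y"
    then show "E x y \<and> {x, y} \<notin> ?F"
      using kept_sym by (auto simp: doubleton_eq_iff) (simp add: kept_def)
  qed auto
  then show ?lhs
    using reach_kept_3 not_reach_kept_2 uv deletion_cost cost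
    by (intro exI[of _ ?F]) auto
qed

end

text \<open>A distance above 3 cannot be repaired by deletions, diameter 3 is witnessed by the empty
  set, and diameter at most 2 is the case of \<open>deletion_iff_separable\<close>.\<close>

theorem meda_yes_3_iff:
  assumes G: "simple_graph G" "verts G \<noteq> {}" and k: "0 < k"
  shows "meda_yes 3 (G, k) \<longleftrightarrow>
    (\<forall>x\<in>verts G. \<forall>y\<in>verts G. reach (adj G) 3 x y) \<and>
    ((\<exists>x\<in>verts G. \<exists>y\<in>verts G. \<not> reach (adj G) 2 x y) \<or>
     (\<exists>u\<in>verts G. \<exists>v\<in>verts G. separable (adj G) u v \<and> sep_cost (adj G) u v \<le> k))"
    (is "_ \<longleftrightarrow> ?near \<and> (?far \<or> ?sep)")
proof -
  let ?del = "\<lambda>F x y. adj G x y \<and> {x, y} \<notin> F"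
  have "meda_yes 3 (G, k) \<longleftrightarrow> (\<exists>F\<subseteq>edges G. card F \<le> k \<and>
      (\<forall>x\<in>verts G. \<forall>y\<in>verts G. reach (?del F) 3 x y) \<and>
      (\<exists>x\<in>verts G. \<exists>y\<in>verts G. \<not> reach (?del F) 2 x y))"
  proof -
    have "simple_graph (del_edges G F)" "verts (del_edges G F) = verts G"
      "adj (del_edges G F) = ?del F" for F
      using G by (auto simp: simple_graph_def del_edges_def)
    then show ?thesis
      using connected_diam_3_iff[of "del_edges G F" for F] G(2) by (simp add: meda_yes_def)
  qed
  also have "\<dots> \<longleftrightarrow> ?near \<and> (?far \<or> ?sep)"
  proof (cases "?near \<and> \<not> ?far")
    case True
    interpret diameter_2 "verts G" "adj G"
    proof
      fix x y
      show "finite (verts G)" using G by (simp add: simple_graph_def)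
      show "adj G x y \<Longrightarrow> adj G y x" by (simp add: insert_commute)
      show "\<not> adj G x x" "adj G x y \<Longrightarrow> x \<in> verts G"
        using G by (force simp: simple_graph_def doubleton_eq_iff)+
      show "x \<in> verts G \<Longrightarrow> y \<in> verts G \<Longrightarrow> x = y \<or> adj G x y \<or> (\<exists>z. adj G x z \<and> adj G z y)"
        using True reach_2_cases[of "adj G" x y] by blast
    qed
    have "{{x, y} | x y. adj G x y} = edges G"
      using G unfolding simple_graph_def by blast
    then show ?thesis using deletion_iff_separable[OF k] True by simp
  next
    case False
    show ?thesis
    proof (cases ?near)
      case True
      with False show ?thesis by (intro iffI) (simp_all, intro exI[of _ "{}"], simp)
    next
      case far: False
      then show ?thesis using reach_mono[of "?del F" 3 _ _ "adj G" for F] by blast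
    qed
  qed
  finally show ?thesis .
qed

section \<open>Compiling bounded expressions\<close>

datatype exp =
    Reg reg
  | Num nat
  | Plus exp exp
  | Minus exp exp
  | Mem exp
  | Cond exp exp exp
  | Horner reg exp exp

text \<open>\<^term>\<open>Horner x a b\<close> lets \<open>x\<close> run below the input length, which is kept in register 0.
  It subsumes bounded sums and the evaluation of a binary numeral.\<close>

primrec eval :: "exp \<Rightarrow> (nat \<Rightarrow> nat) \<Rightarrow> (nat \<Rightarrow> nat) \<Rightarrow> nat" where
  "eval (Reg x) r m = r x"
| "eval (Num n) r m = n"
| "eval (Plus a b) r m = eval a r m + eval b r m"
| "eval (Minus a b) r m = eval a r m - eval b r m"
| "eval (Mem a) r m = m (eval a r m)"
| "eval (Cond a b c) r m = (if eval a r m \<noteq> 0 then eval b r m else eval c r m)"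
| "eval (Horner x a b) r m =
     fold (\<lambda>i s. (if eval a (r(x := i)) m \<noteq> 0 then s + s else s) + eval b (r(x := i)) m) [0..<r 0] 0"

primrec regs_below :: "nat \<Rightarrow> exp \<Rightarrow> bool" where
  "regs_below d (Reg x) \<longleftrightarrow> x < d"
| "regs_below d (Num n) \<longleftrightarrow> True"
| "regs_below d (Plus a b) \<longleftrightarrow> regs_below d a \<and> regs_below d b"
| "regs_below d (Minus a b) \<longleftrightarrow> regs_below d a \<and> regs_below d b"
| "regs_below d (Mem a) \<longleftrightarrow> regs_below d a"
| "regs_below d (Cond a b c) \<longleftrightarrow> regs_below d a \<and> regs_below d b \<and> regs_below d c"
| "regs_below d (Horner x a b) \<longleftrightarrow> 0 < x \<and> x < d \<and> regs_below d a \<and> regs_below d b"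

definition Copy :: "reg \<Rightarrow> reg \<Rightarrow> com" where
  "Copy x y = Seq (Const x 0) (Add x x y)"

text \<open>\<open>d\<close> acts as a stack pointer: the value ends up in register
  \<open>d\<close>, the registers above are scratch space, and those below are preserved. In a loop,
  \<open>d\<close> accumulates, \<open>d + 1\<close> saves the old value of \<open>x\<close>,
  \<open>d + 2\<close> counts the remaining rounds, and the subexpressions work from
  \<open>d + 3\<close> on.\<close>

primrec compile :: "reg \<Rightarrow> exp \<Rightarrow> com" where
  "compile d (Reg x) = Copy d x"
| "compile d (Num n) = Const d n"
| "compile d (Plus a b) = Seq (compile d a) (Seq (compile (d + 1) b) (Add d d (d + 1)))"
| "compile d (Minus a b) = Seq (compile d a) (Seq (compile (d + 1) b) (Sub d d (d + 1)))"
| "compile d (Mem a) = Seq (compile d a) (Load d d)"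
| "compile d (Cond a b c) = Seq (compile d a) (IfNZ d (compile d b) (compile d c))"
| "compile d (Horner x a b) =
     Seq (Const d 0) (Seq (Copy (d + 1) x) (Seq (Copy (d + 2) 0) (Seq (Const x 0) (Seq
       (WhileNZ (d + 2)
         (Seq (compile (d + 3) a) (Seq (IfNZ (d + 3) (Add d d d) Skip)
         (Seq (compile (d + 3) b) (Seq (Add d d (d + 3))
         (Seq (Const (d + 3) 1) (Seq (Add x x (d + 3)) (Sub (d + 2) (d + 2) (d + 3)))))))))
       (Copy x (d + 1))))))"

text \<open>The variable is the input length, which is the number of rounds of every loop. Per round
  there are 6 steps of bookkeeping and one test; the 9 covers set-up, restoring \<open>x\<close> and
  the final test.\<close>

primrec cost :: "exp \<Rightarrow> nat poly" where
  "cost (Reg x) = 2"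
| "cost (Num n) = 1"
| "cost (Plus a b) = cost a + cost b + 1"
| "cost (Minus a b) = cost a + cost b + 1"
| "cost (Mem a) = cost a + 1"
| "cost (Cond a b c) = cost a + cost b + cost c + 1"
| "cost (Horner x a b) = [:0, 1:] * (cost a + cost b + 7) + 9"

lemma regs_below_mono: "regs_below d e \<Longrightarrow> d \<le> d' \<Longrightarrow> regs_below d' e"
  by (induction e) auto

text \<open>\<open>0 < d\<close> includes register 0, from which loops read their bound.\<close>

lemma eval_cong:
  "regs_below d e \<Longrightarrow> 0 < d \<Longrightarrow> (\<And>i. i < d \<Longrightarrow> r i = r' i) \<Longrightarrow> eval e r m = eval e r' m"
proof (induction e arbitrary: r r')
  case (Horner x a b)
  have "eval a (r(x := i)) m = eval a (r'(x := i)) m" "eval b (r(x := i)) m = eval b (r'(x := i)) m" for i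
    using Horner.prems by (intro Horner.IH; simp)+
  moreover have "r 0 = r' 0" using Horner.prems by simp
  ultimately show ?case by simp
next
  case (Plus a b)
  have "eval a r m = eval a r' m" "eval b r m = eval b r' m"
    using Plus.prems by (intro Plus.IH; simp)+
  then show ?case by simp
next
  case (Minus a b)
  have "eval a r m = eval a r' m" "eval b r m = eval b r' m"
    using Minus.prems by (intro Minus.IH; simp)+
  then show ?case by simp
next
  case (Mem a)
  have "eval a r m = eval a r' m"
    using Mem.prems by (intro Mem.IH; simp)+
  then show ?case by simp
next
  case (Cond a b c)
  have "eval a r m = eval a r' m" "eval b r m = eval b r' m" "eval c r m = eval c r' m"
    using Cond.prems by (intro Cond.IH; simp)+
  then show ?case by simp
qed simp_all

section \<open>Correctness and running time of compiled expressions\<close>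

text \<open>An upper bound replaces the exact time, so that branches of different length fit under
  one bound. The memory stays fixed because compiled expressions only load from it.\<close>

definition runs :: "com \<Rightarrow> (nat \<Rightarrow> nat) \<Rightarrow> (nat \<Rightarrow> nat) \<Rightarrow> nat \<Rightarrow> (nat \<Rightarrow> nat) \<Rightarrow> bool" where
  "runs c r m b r' \<longleftrightarrow> (\<exists>t\<le>b. exec c (r, m) t (r', m))"

lemma runs_Skip: "runs Skip r m 1 r"
  and runs_Const: "runs (Const x n) r m 1 (r(x := n))"
  and runs_Add: "runs (Add x y z) r m 1 (r(x := r y + r z))"
  and runs_Sub: "runs (Sub x y z) r m 1 (r(x := r y - r z))"
  and runs_Load: "runs (Load x y) r m 1 (r(x := m (r y)))"
  unfolding runs_def by (blast intro: exec.intros)+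

lemma runs_Seq: "runs c1 r m b1 r1 \<Longrightarrow> runs c2 r1 m b2 r2 \<Longrightarrow> runs (Seq c1 c2) r m (b1 + b2) r2"
  unfolding runs_def by (meson add_mono exec.Seq)

lemma runs_IfTrue: "r x \<noteq> 0 \<Longrightarrow> runs c1 r m b r' \<Longrightarrow> runs (IfNZ x c1 c2) r m (b + 1) r'"
  unfolding runs_def by (metis Suc_eq_plus1 Suc_le_mono exec.IfTrue fst_conv)

lemma runs_IfFalse: "r x = 0 \<Longrightarrow> runs c2 r m b r' \<Longrightarrow> runs (IfNZ x c1 c2) r m (b + 1) r'"
  unfolding runs_def by (metis Suc_eq_plus1 Suc_le_mono exec.IfFalse fst_conv)

lemma runs_mono: "runs c r m b r' \<Longrightarrow> b \<le> b' \<Longrightarrow> runs c r m b' r'"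
  unfolding runs_def by (meson le_trans)

lemma runs_Copy: "x \<noteq> y \<Longrightarrow> runs (Copy x y) r m 2 (r(x := r y))"
  using runs_Seq[OF runs_Const[of x 0 r m] runs_Add[of x x y _ m]] by (simp add: Copy_def numeral_2_eq_2)

lemma runs_While:
  assumes body: "\<And>i r. i < n \<Longrightarrow> I i r \<Longrightarrow> \<exists>r'. runs c r m b r' \<and> I (Suc i) r'"
    and counter: "\<And>i r. I i r \<Longrightarrow> r y = n - i"
    and start: "I i r" "i \<le> n"
  shows "\<exists>r'. runs (WhileNZ y c) r m ((n - i) * (b + 1) + 1) r' \<and> I n r'"
  using start
proof (induction "n - i" arbitrary: i r)
  case 0
  then have "i = n" "r y = 0" using counter[of i r] by auto
  then show ?case using 0 unfolding runs_def by (auto intro!: exI[of _ r] exI[of _ "1"] exec.WhileFalse)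
next
  case (Suc k)
  then have i: "i < n" by simp
  from body[OF i Suc.prems(1)] obtain r1 t1
    where 1: "t1 \<le> b" "exec c (r, m) t1 (r1, m)" "I (Suc i) r1" unfolding runs_def by auto
  have k: "k = n - Suc i" using Suc.hyps(2) by simp
  from Suc.hyps(1)[OF k 1(3)] i obtain r2 t2
    where 2: "t2 \<le> (n - Suc i) * (b + 1) + 1" "exec (WhileNZ y c) (r1, m) t2 (r2, m)" "I n r2"
    unfolding runs_def by auto
  have "r y \<noteq> 0" using counter[OF Suc.prems(1)] i by simp
  then have "exec (WhileNZ y c) (r, m) (Suc (t1 + t2)) (r2, m)"
    using exec.WhileTrue[OF _ 1(2) 2(2)] by simp
  moreover have "Suc (t1 + t2) \<le> (n - i) * (b + 1) + 1"
  proof -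
    have "n - i = Suc (n - Suc i)" using i by simp
    then have "(n - i) * (b + 1) + 1 = (b + 1) + ((n - Suc i) * (b + 1) + 1)" by simp
    then show ?thesis using 1(1) 2(1) by linarith
  qed
  ultimately show ?case using 2(3) unfolding runs_def by blast
qed

text \<open>Later operands run at a shifted \<open>d\<close> from changed registers, so both are
  generalised. Preservation below \<open>d\<close> protects the variables and the earlier results;
  by \<open>eval_cong\<close> a later operand still has its original value.\<close>

lemma compile_correct:
  assumes "regs_below d e" "0 < d"
  shows "\<exists>r'. runs (compile d e) r m (poly (cost e) (r 0)) r' \<and> r' d = eval e r m \<and> (\<forall>i<d. r' i = r i)"
  using assms
proof (induction e arbitrary: d r)
  case (Reg x)
  then show ?case using runs_Copy[of d x r m] by (intro exI) auto
next
  case (Num n)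
  then show ?case using runs_Const[of d n r m] by (intro exI) auto
next
  case (Plus a b)
  obtain r1 where 1: "runs (compile d a) r m (poly (cost a) (r 0)) r1" "r1 d = eval a r m" "\<forall>i<d. r1 i = r i"
    using Plus.IH(1)[of d r] Plus.prems by auto
  obtain r2 where 2: "runs (compile (d + 1) b) r1 m (poly (cost b) (r1 0)) r2"
      "r2 (d + 1) = eval b r1 m" "\<forall>i<d + 1. r2 i = r1 i"
    using Plus.IH(2)[of "d + 1" r1] Plus.prems regs_below_mono[of d b "d + 1"] by auto
  have "eval b r1 m = eval b r m" using 1 Plus.prems by (intro eval_cong[of d]) auto
  then show ?case
    using runs_Seq[OF 1(1) runs_Seq[OF 2(1) runs_Add[of d d "d + 1"]]] 1 2 Plus.prems
    by (intro exI) (auto simp: add.assoc)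
next
  case (Minus a b)
  obtain r1 where 1: "runs (compile d a) r m (poly (cost a) (r 0)) r1" "r1 d = eval a r m" "\<forall>i<d. r1 i = r i"
    using Minus.IH(1)[of d r] Minus.prems by auto
  obtain r2 where 2: "runs (compile (d + 1) b) r1 m (poly (cost b) (r1 0)) r2"
      "r2 (d + 1) = eval b r1 m" "\<forall>i<d + 1. r2 i = r1 i"
    using Minus.IH(2)[of "d + 1" r1] Minus.prems regs_below_mono[of d b "d + 1"] by auto
  have "eval b r1 m = eval b r m" using 1 Minus.prems by (intro eval_cong[of d]) auto
  then show ?case
    using runs_Seq[OF 1(1) runs_Seq[OF 2(1) runs_Sub[of d d "d + 1"]]] 1 2 Minus.prems
    by (intro exI) (auto simp: add.assoc)
next
  case (Mem a)
  obtain r1 where 1: "runs (compile d a) r m (poly (cost a) (r 0)) r1" "r1 d = eval a r m" "\<forall>i<d. r1 i = r i"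
    using Mem.IH[of d r] Mem.prems by auto
  then show ?case using runs_Seq[OF 1(1) runs_Load[of d d]] by (intro exI) auto
next
  case (Cond a b c)
  obtain r1 where 1: "runs (compile d a) r m (poly (cost a) (r 0)) r1" "r1 d = eval a r m" "\<forall>i<d. r1 i = r i"
    using Cond.IH(1)[of d r] Cond.prems by auto
  have eq: "eval b r1 m = eval b r m" "eval c r1 m = eval c r m" "r1 0 = r 0"
    using 1 Cond.prems by (auto intro!: eval_cong[of d])
  obtain r2 where 2: "runs (compile d b) r1 m (poly (cost b) (r 0)) r2" "r2 d = eval b r m" "\<forall>i<d. r2 i = r1 i"
    using Cond.IH(2)[of d r1] Cond.prems eq by auto
  obtain r3 where 3: "runs (compile d c) r1 m (poly (cost c) (r 0)) r3" "r3 d = eval c r m" "\<forall>i<d. r3 i = r1 i"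
    using Cond.IH(3)[of d r1] Cond.prems eq by auto
  show ?case
  proof (cases "eval a r m = 0")
    case True
    then have "runs (IfNZ d (compile d b) (compile d c)) r1 m (poly (cost c) (r 0) + 1) r3"
      using 1 3 by (intro runs_IfFalse) auto
    from runs_mono[OF runs_Seq[OF 1(1) this]] show ?thesis using 1 3 True by (intro exI) auto
  next
    case False
    then have "runs (IfNZ d (compile d b) (compile d c)) r1 m (poly (cost b) (r 0) + 1) r2"
      using 1 2 by (intro runs_IfTrue) auto
    from runs_mono[OF runs_Seq[OF 1(1) this]] show ?thesis using 1 2 False by (intro exI) auto
  qed
next
  case (Horner x a b)
  let ?A = "poly (cost a) (r 0)" and ?B = "poly (cost b) (r 0)"
  define f where "f i s = (if eval a (r(x := i)) m \<noteq> 0 then s + s else s) + eval b (r(x := i)) m" for i s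
  \<comment> \<open>Below \<open>d\<close> the registers look as if \<open>x\<close> had been set to
    \<open>i\<close>, which makes the subexpressions compute their values for round
    \<open>i\<close>.\<close>
  define I where "I i q \<longleftrightarrow> (\<forall>j<d. q j = (r(x := i)) j) \<and> q d = fold f [0..<i] 0 \<and>
    q (d + 1) = r x \<and> q (d + 2) = r 0 - i" for i q
  have x: "0 < x" "x < d" and ab: "regs_below d a" "regs_below d b" using Horner.prems by auto
  let ?body = "Seq (compile (d + 3) a) (Seq (IfNZ (d + 3) (Add d d d) Skip)
         (Seq (compile (d + 3) b) (Seq (Add d d (d + 3))
         (Seq (Const (d + 3) 1) (Seq (Add x x (d + 3)) (Sub (d + 2) (d + 2) (d + 3)))))))"
  have body: "\<exists>q'. runs ?body q m (?A + ?B + 6) q' \<and> I (Suc i) q'" if i: "i < r 0" and I: "I i q" for i q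
  proof -
    have ev: "eval e p m = eval e (r(x := i)) m"
      if "regs_below d e" "\<forall>j<d. p j = q j" for e p
      using that I Horner.prems(2) by (intro eval_cong[of d]) (auto simp: I_def)
    have q0: "q 0 = r 0" using I x by (auto simp: I_def)
    obtain q1 where 1: "runs (compile (d + 3) a) q m ?A q1"
        "q1 (d + 3) = eval a (r(x := i)) m" "\<forall>j<d + 3. q1 j = q j"
      using Horner.IH(1)[of "d + 3" q] regs_below_mono[OF ab(1), of "d + 3"] ev[OF ab(1)] q0 by auto
    define q2 where "q2 = (if q1 (d + 3) = 0 then q1 else q1(d := q1 d + q1 d))"
    have 2: "runs (IfNZ (d + 3) (Add d d d) Skip) q1 m (1 + 1) q2"
      unfolding q2_def using runs_IfTrue[OF _ runs_Add] runs_IfFalse[OF _ runs_Skip] by auto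
    have q2: "\<forall>j<d + 3. j \<noteq> d \<longrightarrow> q2 j = q j"
      "q2 d = (if eval a (r(x := i)) m \<noteq> 0 then q d + q d else q d)"
      using 1 by (auto simp: q2_def)
    obtain q3 where 3: "runs (compile (d + 3) b) q2 m ?B q3"
        "q3 (d + 3) = eval b (r(x := i)) m" "\<forall>j<d + 3. q3 j = q2 j"
      using Horner.IH(2)[of "d + 3" q2] regs_below_mono[OF ab(2), of "d + 3"] ev[OF ab(2), of q2] q0 q2
        Horner.prems(2) by auto
    note runs_all = runs_Seq[OF 1(1) runs_Seq[OF 2 runs_Seq[OF 3(1) runs_Seq[OF runs_Add[of d d "d + 3"]
      runs_Seq[OF runs_Const[of "d + 3" 1] runs_Seq[OF runs_Add[of x x "d + 3"]
      runs_Sub[of "d + 2" "d + 2" "d + 3"]]]]]]]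
    show ?thesis
    proof (rule exI, rule conjI, rule runs_mono[OF runs_all], goal_cases)
      case 2
      then show ?case using 3 q2 I x i by (auto simp: I_def f_def)
    qed simp
  qed
  let ?r0 = "r(d := 0, d + 1 := r x, d + 2 := r 0, x := 0)"
  have "I 0 ?r0" using x by (auto simp: I_def)
  then have loop: "\<exists>q. runs (WhileNZ (d + 2) ?body) ?r0 m ((r 0 - 0) * (?A + ?B + 6 + 1) + 1) q \<and> I (r 0) q"
    by (intro runs_While body) (use x in \<open>auto simp: I_def\<close>)
  have iterations: "(r 0 - 0) * (?A + ?B + 6 + 1) + 1 = r 0 * (?A + ?B + 7) + 1" by simp
  from loop obtain q where q: "runs (WhileNZ (d + 2) ?body) ?r0 m (r 0 * (?A + ?B + 7) + 1) q" "I (r 0) q"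
    unfolding iterations by blast
  have start: "runs (Copy (d + 1) x) (r(d := 0)) m 2 (r(d := 0, d + 1 := r x))"
    "runs (Copy (d + 2) 0) (r(d := 0, d + 1 := r x)) m 2 (r(d := 0, d + 1 := r x, d + 2 := r 0))"
    using runs_Copy[of "d + 1" x "r(d := 0)" m] runs_Copy[of "d + 2" 0 "r(d := 0, d + 1 := r x)" m]
      x by auto
  have finish: "runs (Copy x (d + 1)) q m 2 (q(x := q (d + 1)))" using x by (intro runs_Copy) auto
  note runs_all = runs_Seq[OF runs_Const[of d 0] runs_Seq[OF start(1) runs_Seq[OF start(2)
    runs_Seq[OF runs_Const[of x 0] runs_Seq[OF q(1) finish]]]]]
  have "runs (compile d (Horner x a b)) r m (poly (cost (Horner x a b)) (r 0)) (q(x := q (d + 1)))"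
    unfolding compile.simps by (rule runs_mono[OF runs_all]) simp
  moreover have "(q(x := q (d + 1))) d = eval (Horner x a b) r m"
    using q(2) x by (auto simp: I_def f_def[abs_def])
  moreover have "\<forall>i<d. (q(x := q (d + 1))) i = r i" using q(2) by (auto simp: I_def)
  ultimately show ?case by blast
qed

section \<open>Logical connectives as expressions\<close>

definition holds :: "exp \<Rightarrow> (nat \<Rightarrow> nat) \<Rightarrow> (nat \<Rightarrow> nat) \<Rightarrow> bool" where
  "holds e r m \<longleftrightarrow> eval e r m \<noteq> 0"

lemma polytime_solvable_if_exp:
  assumes e: "regs_below d e" "0 < d"
    and Q: "\<And>x. x \<in> Inst \<Longrightarrow> holds e (fst (init_state (enc x))) (snd (init_state (enc x))) \<longleftrightarrow> Q x"
  shows "polytime_solvable enc Inst Q"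
  unfolding polytime_solvable_def
proof (rule exI[of _ "Seq (compile d e) (Copy 0 d)"], rule exI[of _ "cost e + 2"], rule ballI)
  fix x assume x: "x \<in> Inst"
  define r m where "r = fst (init_state (enc x))" and "m = snd (init_state (enc x))"
  have r0: "r 0 = length (enc x)" by (simp add: r_def init_state_def)
  from compile_correct[OF e, of r m] obtain r' where
    r': "runs (compile d e) r m (poly (cost e) (r 0)) r'" "r' d = eval e r m" by blast
  have "runs (Seq (compile d e) (Copy 0 d)) r m (poly (cost e) (r 0) + 2) (r'(0 := r' d))"
    using e(2) by (intro runs_Seq[OF r'(1) runs_Copy]) simp
  moreover have "accepting (r'(0 := r' d), m) \<longleftrightarrow> Q x"
    using r'(2) Q[OF x] by (simp add: accepting_def holds_def r_def m_def)
  ultimately show "\<exists>t s. exec (Seq (compile d e) (Copy 0 d)) (init_state (enc x)) t s \<and>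
      t \<le> poly (cost e + 2) (length (enc x)) \<and> (accepting s \<longleftrightarrow> Q x)"
    unfolding runs_def r0 by (auto simp: r_def m_def)
qed

text \<open>Since truth means being nonzero, addition is disjunction, truncated subtraction is
  strict comparison, and summation is both counting and bounded existence. \<open>Neg\<close> always
  yields 0 or 1.\<close>

definition Neg :: "exp \<Rightarrow> exp" where "Neg a = Cond a (Num 0) (Num 1)"
definition And :: "exp \<Rightarrow> exp \<Rightarrow> exp" where "And a b = Cond a b (Num 0)"
definition Conj :: "exp list \<Rightarrow> exp" where "Conj es = foldr And es (Num 1)"
definition Or :: "exp \<Rightarrow> exp \<Rightarrow> exp" where "Or a b = Plus a b"
definition Less :: "exp \<Rightarrow> exp \<Rightarrow> exp" where "Less a b = Minus b a"
definition Equal :: "exp \<Rightarrow> exp \<Rightarrow> exp" where "Equal a b = Neg (Or (Less a b) (Less b a))"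
definition Sum :: "reg \<Rightarrow> exp \<Rightarrow> exp" where "Sum x a = Horner x (Num 0) a"
definition Forall :: "reg \<Rightarrow> exp \<Rightarrow> exp" where "Forall x a = Neg (Sum x (Neg a))"

lemmas exp_defs = Neg_def And_def Conj_def Or_def Less_def Equal_def Sum_def Forall_def

lemma eval_Neg: "eval (Neg a) r m = of_bool (\<not> holds a r m)"
  by (simp add: Neg_def holds_def)

lemma eval_Cond: "eval (Cond a b c) r m = (if holds a r m then eval b r m else eval c r m)"
  by (simp add: holds_def)

lemma eval_Sum: "eval (Sum x a) r m = (\<Sum>i<r 0. eval a (r(x := i)) m)"
proof -
  have "fold (\<lambda>i s. s + f i) [0..<n] 0 = (\<Sum>i<n. f i)" for f :: "nat \<Rightarrow> nat" and n
    by (induction n) simp_all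
  then show ?thesis by (simp add: Sum_def)
qed

lemma holds_Reg: "holds (Reg x) r m \<longleftrightarrow> r x \<noteq> 0"
  and holds_Mem: "holds (Mem a) r m \<longleftrightarrow> m (eval a r m) \<noteq> 0"
  and holds_Neg: "holds (Neg a) r m \<longleftrightarrow> \<not> holds a r m"
  and holds_And: "holds (And a b) r m \<longleftrightarrow> holds a r m \<and> holds b r m"
  and holds_Or: "holds (Or a b) r m \<longleftrightarrow> holds a r m \<or> holds b r m"
  and holds_Less: "holds (Less a b) r m \<longleftrightarrow> eval a r m < eval b r m"
  and holds_Sum: "holds (Sum x a) r m \<longleftrightarrow> (\<exists>i<r 0. holds a (r(x := i)) m)"
  by (auto simp: holds_def eval_Sum exp_defs(1,2,4,5))

lemma holds_Equal: "holds (Equal a b) r m \<longleftrightarrow> eval a r m = eval b r m"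
  by (auto simp: Equal_def holds_Neg holds_Or holds_Less)

lemma holds_Conj: "holds (Conj es) r m \<longleftrightarrow> (\<forall>e\<in>set es. holds e r m)"
  unfolding Conj_def by (induction es) (simp_all add: holds_And, simp add: holds_def)

lemma holds_Forall: "holds (Forall x a) r m \<longleftrightarrow> (\<forall>i<r 0. holds a (r(x := i)) m)"
  by (auto simp: Forall_def holds_Neg holds_Sum)

lemmas holds_simps = holds_Reg holds_Mem holds_Neg holds_And holds_Or holds_Less holds_Sum holds_Equal
  holds_Conj holds_Forall

section \<open>Deciding 3-MEDA\<close>

text \<open>Registers 1 and 2 are scratch variables of the expressions that decode the input;
  the others hold vertices, with the pair under consideration in 3 and 4. In \<open>Budget\<close>, register 3 is the
  distance from the end of the input, since the bits of \<open>k\<close> come least significant first.\<close>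

definition Vertices :: exp where
  "Vertices = Sum 1 (Forall 2 (Or (Less (Reg 1) (Reg 2)) (Mem (Reg 2))))"

text \<open>Multiplication by repeated addition. The value of \<open>a\<close> must not depend on
  register 1, the loop variable.\<close>

definition times_Vertices :: "exp \<Rightarrow> exp" where
  "times_Vertices a = Sum 1 (Cond (Less (Reg 1) Vertices) a (Num 0))"

definition Vertex :: "reg \<Rightarrow> exp" where
  "Vertex x = Less (Reg x) Vertices"

text \<open>The unary part and the separator precede the matrix. The guards keep an index that is
  not a vertex from being read as another entry or as a bit of \<open>k\<close>.\<close>

definition Edge :: "reg \<Rightarrow> reg \<Rightarrow> exp" where
  "Edge x y = Conj [Vertex x, Vertex y,
     Mem (Plus (Plus Vertices (Num 1)) (Plus (times_Vertices (Reg x)) (Reg y)))]"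

definition Budget :: exp where
  "Budget = (let a = Minus (Minus (Reg 0) (Num 1)) (Reg 3);
     b = Less (Plus Vertices (times_Vertices Vertices)) a in Horner 3 b (Cond b (Mem a) (Num 0)))"

definition Step :: "reg \<Rightarrow> reg \<Rightarrow> exp" where
  "Step x y = Or (Equal (Reg x) (Reg y)) (Edge x y)"

definition Reach_2 :: exp where
  "Reach_2 = Sum 5 (And (Step 3 5) (Step 5 4))"

definition Reach_3 :: exp where
  "Reach_3 = Sum 5 (And (Step 3 5) (Sum 6 (And (Step 5 6) (Step 6 4))))"

definition Separable :: exp where
  "Separable = Conj [Neg (Equal (Reg 3) (Reg 4)),
     Forall 5 (Or (Neg (And (Edge 3 5) (Edge 4 5))) (Sum 6 (Sum 7 (Conj
       [Neg (Equal (Reg 6) (Reg 3)), Neg (Equal (Reg 6) (Reg 4)),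
        Neg (Equal (Reg 7) (Reg 3)), Neg (Equal (Reg 7) (Reg 4)), Neg (Equal (Reg 7) (Reg 5)),
        Or (Edge 3 7) (Edge 4 7), Step 5 6, Step 6 7])))),
     Sum 5 (Sum 6 (Conj [Edge 3 5, Neg (Equal (Reg 5) (Reg 4)), Edge 4 6, Neg (Equal (Reg 6) (Reg 3)),
       Edge 5 6]))]"

text \<open>Double negation yields exactly 0 or 1, so that \<open>Sum\<close> counts the common
  neighbours.\<close>

definition Sep_cost :: exp where
  "Sep_cost = Plus (Sum 5 (Neg (Neg (And (Edge 3 5) (Edge 4 5))))) (Neg (Neg (Edge 3 4)))"

text \<open>Loops range over all numbers below the input length, hence the guards by
  \<open>Vertex\<close>.\<close>

definition Meda_3 :: exp where
  "Meda_3 = And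
     (Forall 3 (Forall 4 (Or (Neg (And (Vertex 3) (Vertex 4))) Reach_3)))
     (Sum 3 (Sum 4 (Conj [Vertex 3, Vertex 4,
       Or (Neg Reach_2) (And Separable (Neg (Less Budget Sep_cost)))])))"

lemma regs_below_Meda_3: "regs_below 8 Meda_3"
  by (simp add: Meda_3_def Vertices_def times_Vertices_def Vertex_def Edge_def Budget_def Step_def
      Reach_2_def Reach_3_def Separable_def Sep_cost_def exp_defs Let_def)

section \<open>Decoding the input\<close>

definition num_of_bits :: "bool list \<Rightarrow> nat" where
  "num_of_bits bs = foldr (\<lambda>b s. of_bool b + 2 * s) bs 0"

lemma num_of_bits_binary: "num_of_bits (binary k) = k"
proof (induction k rule: binary.induct)
  case (1 k)
  show ?case
  proof (cases "k = 0")
    case False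
    then have "num_of_bits (binary k) = of_bool (odd k) + 2 * (k div 2)"
      using 1 by (subst binary.simps) (simp add: num_of_bits_def)
    then show ?thesis by simp
  qed (simp add: binary.simps num_of_bits_def)
qed

lemma length_concat_rows: "length (concat (map (\<lambda>i. map (f i) [0..<n]) [0..<k])) = k * n"
  by (induction k) simp_all

lemma nth_concat_rows:
  "i < k \<Longrightarrow> j < n \<Longrightarrow> concat (map (\<lambda>i. map (f i) [0..<n]) [0..<k]) ! (i * n + j) = f i j"
proof (induction k)
  case (Suc k)
  have "i * n + j < k * n" if "i < k"
  proof -
    have "i * n + j < Suc i * n" using Suc.prems by simp
    also have "\<dots> \<le> k * n" using that by (intro mult_le_mono1) simp
    finally show ?thesis .
  qed
  moreover have "i < k \<or> i = k" using Suc.prems by auto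
  ultimately show ?case
    using Suc by (auto simp: nth_append length_concat_rows)
qed simp

text \<open>\<open>s\<close> is the address of the first bit. Addresses descend from the end of the
  input, so the first \<open>length bs\<close> rounds are Horner's rule from the most significant
  bit; afterwards the test fails and the value no longer changes.\<close>

lemma fold_Horner_bits:
  assumes "\<And>t. t < length bs \<Longrightarrow> m (s + t) = of_bool (bs ! t)"
  shows "fold (\<lambda>i v. (if s \<le> s + length bs - 1 - i then v + v else v) +
      (if s \<le> s + length bs - 1 - i then m (s + length bs - 1 - i) else 0)) [0..<s + length bs] 0
    = num_of_bits bs"
proof -
  let ?l = "length bs"
  define f where "f i v = (if s \<le> s + ?l - 1 - i then v + v else v) +
    (if s \<le> s + ?l - 1 - i then m (s + ?l - 1 - i) else 0)" for i v
  have top: "fold f [0..<j] 0 = num_of_bits (drop (?l - j) bs)" if "j \<le> ?l" for j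
    using that
  proof (induction j)
    case 0
    then show ?case by (simp add: num_of_bits_def)
  next
    case (Suc j)
    let ?t = "?l - Suc j"
    have pos: "s + ?l - 1 - j = s + ?t" "?t < ?l" "Suc ?t = ?l - j" using Suc.prems by auto
    have "drop ?t bs = bs ! ?t # drop (?l - j) bs"
      using Cons_nth_drop_Suc[OF pos(2)] pos(3) by simp
    then show ?case
      using Suc assms[OF pos(2)] pos(1) by (simp add: f_def num_of_bits_def)
  qed
  have "fold f [0..<?l + j] 0 = num_of_bits bs" if "j \<le> s" for j
    using that
  proof (induction j)
    case 0
    then show ?case using top[of ?l] by simp
  next
    case (Suc j)
    have "\<not> s \<le> s + ?l - 1 - (?l + j)" using Suc.prems by simp
    then show ?case using Suc by (simp add: f_def)
  qed
  from this[of s] show ?thesis by (simp add: f_def[abs_def] add.commute)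
qed

locale meda_input =
  fixes G :: "nat graph" and k n L :: nat and m :: "nat \<Rightarrow> nat"
  assumes simple: "simple_graph G" and verts: "verts G = {..<n}"
    and L: "L = length (meda_encode (G, k))"
    and m: "m = snd (init_state (meda_encode (G, k)))"
begin

lemma length_encode: "L = n + 1 + n * n + length (binary k)"
  by (simp add: L meda_encode_def verts length_concat_rows Let_def)

lemma memory_unary: "i < n \<Longrightarrow> m i = 1" "m n = 0"
  by (simp_all add: m init_state_def meda_encode_def verts nth_append Let_def)

lemma memory_matrix:
  assumes "i < n" "j < n"
  shows "m (n + 1 + (i * n + j)) = of_bool (adj G i j)"
proof -
  have "i * n + j < Suc i * n" using assms by simp
  also have "\<dots> \<le> n * n" using assms by (intro mult_le_mono1) simp
  finally have lt: "i * n + j < n * n" .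
  then have "n + 1 + (i * n + j) < L" by (simp add: length_encode)
  moreover have "meda_encode (G, k) ! (n + 1 + (i * n + j)) = adj G i j"
    using lt nth_concat_rows[OF assms, of "adj G"] 
    by (simp add: meda_encode_def verts nth_append length_concat_rows Let_def)
  ultimately show ?thesis by (simp add: m init_state_def L)
qed

lemma memory_budget:
  assumes "t < length (binary k)"
  shows "m (n + 1 + n * n + t) = of_bool (binary k ! t)"
proof -
  have "meda_encode (G, k) ! (n + 1 + n * n + t) = binary k ! t"
    by (simp add: meda_encode_def verts nth_append length_concat_rows Let_def)
  then show ?thesis using assms length_encode by (simp add: m init_state_def flip: L)
qed

lemma adj_less: "adj G x y \<Longrightarrow> x < n \<and> y < n"
  using simple unfolding simple_graph_def verts by (auto simp: doubleton_eq_iff)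

lemma n_less_L: "n < L" by (simp add: length_encode)

lemma vertices_below_L: "{..<L} \<inter> {i. i < n} = {..<n}" using n_less_L by auto

text \<open>A position is counted iff no zero occurs up to it. The first zero is the separator at
  address \<open>n\<close>, which \<open>n_less_L\<close> places within the range of the inner
  quantifier.\<close>

lemma eval_Vertices:
  assumes r0: "r 0 = L"
  shows "eval Vertices r m = n"
proof -
  have "(\<forall>j<L. i < j \<or> m j \<noteq> 0) \<longleftrightarrow> i < n" if "i < L" for i
    using memory_unary n_less_L by (metis less_le_trans linorder_not_le nat_less_le zero_neq_one)
  then have "eval Vertices r m = (\<Sum>i<L. of_bool (i < n))"
    unfolding Vertices_def eval_Sum Forall_def eval_Neg
    by (intro sum.cong) (simp_all add: holds_simps r0)
  also have "\<dots> = n" by (simp add: vertices_below_L)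
  finally show ?thesis .
qed

lemma holds_Vertex: "r 0 = L \<Longrightarrow> holds (Vertex x) r m \<longleftrightarrow> r x < n"
  by (simp add: Vertex_def holds_Less eval_Vertices)

lemma eval_times_Vertices:
  assumes "r 0 = L" "\<And>i. eval a (r(1 := i)) m = c"
  shows "eval (times_Vertices a) r m = n * c"
proof -
  have "eval (times_Vertices a) r m = (\<Sum>i<L. if i < n then c else 0)"
    using assms by (simp add: times_Vertices_def eval_Sum eval_Cond holds_Less eval_Vertices del: eval.simps(6) cong: if_cong)
  also have "\<dots> = n * c" by (simp add: sum.If_cases vertices_below_L)
  finally show ?thesis by simp
qed

text \<open>Register 1 is excluded because \<open>times_Vertices\<close> uses it as its loop
  variable.\<close>

lemma holds_Edge:
  assumes "r 0 = L" "x \<noteq> 1" "y \<noteq> 1"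
  shows "holds (Edge x y) r m \<longleftrightarrow> adj G (r x) (r y)"
proof (cases "r x < n \<and> r y < n")
  case True
  then show ?thesis
    using assms memory_matrix[of "r x" "r y"] eval_times_Vertices[of r "Reg x" "r x"]
    by (simp add: Edge_def holds_Conj holds_Vertex, simp add: holds_def eval_Vertices mult.commute)
next
  case False
  then show ?thesis using assms adj_less by (auto simp: Edge_def holds_Conj holds_Vertex)
qed

lemma holds_Step:
  "r 0 = L \<Longrightarrow> x \<noteq> 1 \<Longrightarrow> y \<noteq> 1 \<Longrightarrow> holds (Step x y) r m \<longleftrightarrow> r x = r y \<or> adj G (r x) (r y)"
  by (simp add: Step_def holds_simps holds_Edge)

lemma eval_Budget:
  assumes "r 0 = L"
  shows "eval Budget r m = k"
proof -
  let ?a = "Minus (Minus (Reg 0) (Num 1)) (Reg 3)"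
  let ?b = "Less (Plus Vertices (times_Vertices Vertices)) ?a"
  let ?s = "n + 1 + n * n"
  have b: "holds ?b (r(3 := i)) m \<longleftrightarrow> ?s \<le> L - 1 - i" for i
    using assms
    by (simp add: holds_Less eval_Vertices eval_times_Vertices[of _ Vertices n] Suc_le_eq)
  have "eval Budget r m = fold (\<lambda>i v. (if holds ?b (r(3 := i)) m then v + v else v) +
      (if holds ?b (r(3 := i)) m then m (L - 1 - i) else 0)) [0..<L] 0"
    using assms by (simp add: Budget_def Let_def holds_def cong: if_cong)
  also have "\<dots> = num_of_bits (binary k)"
    unfolding b using fold_Horner_bits[of "binary k" m ?s, OF memory_budget] by (simp only: length_encode)
  finally show ?thesis by (simp add: num_of_bits_binary)
qed

lemma holds_Reach_2:
  assumes "r 0 = L" "r 3 < n" "r 4 < n"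
  shows "holds Reach_2 r m \<longleftrightarrow> reach (adj G) 2 (r 3) (r 4)"
proof -
  have "z < L" if "r 3 = z \<or> adj G (r 3) z" for z
    using that adj_less n_less_L assms(2) by (meson less_trans)
  then show ?thesis
    using assms by (auto simp: Reach_2_def holds_simps holds_Step reach_2)
qed

lemma holds_Reach_3:
  assumes "r 0 = L" "r 3 < n" "r 4 < n"
  shows "holds Reach_3 r m \<longleftrightarrow> reach (adj G) 3 (r 3) (r 4)"
proof -
  have "z < L" if "r 3 = z \<or> adj G (r 3) z" for z
    using that adj_less n_less_L assms(2) by (meson less_trans)
  moreover have "w < L" if "w = r 4 \<or> adj G w (r 4)" for w
    using that adj_less n_less_L assms(3) by (meson less_trans)
  ultimately show ?thesis
    using assms by (simp add: Reach_3_def holds_simps holds_Step reach_3) blast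
qed

lemma holds_Separable:
  assumes "r 0 = L" "r 3 < n" "r 4 < n"
  shows "holds Separable r m \<longleftrightarrow> separable (adj G) (r 3) (r 4)"
proof -
  let ?u = "r 3" and ?v = "r 4"
  have lt: "x < L \<and> y < L" if "adj G x y" for x y
    using that adj_less n_less_L by (meson less_trans)
  define Q where "Q c z w \<longleftrightarrow> z \<notin> {?u, ?v} \<and> w \<notin> {?u, ?v, c} \<and> (adj G ?u w \<or> adj G ?v w) \<and>
    (c = z \<or> adj G c z) \<and> (z = w \<or> adj G z w)" for c z w
  \<comment> \<open>Bounding the witnesses by \<open>L\<close> loses nothing: \<open>w\<close> is a
    neighbour of \<open>u\<close> or \<open>v\<close>, and \<open>z\<close> is \<open>c\<close> or a
    neighbour of \<open>c\<close>.\<close>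
  have Q_lt: "z < L \<and> w < L" if "Q c z w" "adj G ?u c" for c z w
    using that lt unfolding Q_def by blast
  have "holds Separable r m \<longleftrightarrow> ?u \<noteq> ?v \<and>
      (\<forall>c<L. \<not> (adj G ?u c \<and> adj G ?v c) \<or> (\<exists>z<L. \<exists>w<L. Q c z w)) \<and>
      (\<exists>s<L. \<exists>t<L. adj G ?u s \<and> s \<noteq> ?v \<and> adj G ?v t \<and> t \<noteq> ?u \<and> adj G s t)"
    using assms(1) by (simp add: Separable_def holds_simps holds_Step holds_Edge Q_def)
  also have "\<dots> \<longleftrightarrow> ?u \<noteq> ?v \<and> (\<forall>c. adj G ?u c \<and> adj G ?v c \<longrightarrow> (\<exists>z w. Q c z w)) \<and>
      (\<exists>s t. adj G ?u s \<and> s \<noteq> ?v \<and> adj G ?v t \<and> t \<noteq> ?u \<and> adj G s t)"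
    using lt Q_lt by meson
  also have "\<dots> \<longleftrightarrow> separable (adj G) ?u ?v"
    unfolding separable_def Q_def ..
  finally show ?thesis .
qed

lemma eval_Sep_cost:
  assumes "r 0 = L"
  shows "eval Sep_cost r m = sep_cost (adj G) (r 3) (r 4)"
proof -
  have "{..<L} \<inter> {c. adj G (r 3) c \<and> adj G (r 4) c} = {c. adj G (r 3) c \<and> adj G (r 4) c}"
    using adj_less n_less_L by (auto dest: less_trans)
  then show ?thesis
    using assms by (simp add: Sep_cost_def sep_cost_def eval_Sum eval_Neg holds_simps holds_Edge)
qed

lemma holds_Meda_3:
  assumes "r 0 = L" "0 < n" "0 < k"
  shows "holds Meda_3 r m \<longleftrightarrow> meda_yes 3 (G, k)"
proof -
  have vertex: "x < L" if "x < n" for x using that n_less_L by (rule less_trans)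
  have "verts G \<noteq> {}" using assms(2) verts by auto
  from meda_yes_3_iff[OF simple this assms(3)]
  have "meda_yes 3 (G, k) \<longleftrightarrow> (\<forall>x<n. \<forall>y<n. reach (adj G) 3 x y) \<and>
    (\<exists>x<n. \<exists>y<n. \<not> reach (adj G) 2 x y \<or> separable (adj G) x y \<and> sep_cost (adj G) x y \<le> k)"
    unfolding verts Ball_def Bex_def lessThan_iff by blast
  also have "\<dots> \<longleftrightarrow> holds Meda_3 r m"
  proof -
    let ?r = "\<lambda>x y. r(3 := x, 4 := y)"
    have r: "holds Reach_2 (?r x y) m \<longleftrightarrow> reach (adj G) 2 x y"
        "holds Reach_3 (?r x y) m \<longleftrightarrow> reach (adj G) 3 x y"
        "holds Separable (?r x y) m \<longleftrightarrow> separable (adj G) x y" if "x < n" "y < n" for x y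
      using that assms(1) holds_Reach_2[of "?r x y"] holds_Reach_3[of "?r x y"]
        holds_Separable[of "?r x y"] by simp_all
    have "holds Meda_3 r m \<longleftrightarrow>
      (\<forall>x<L. \<forall>y<L. \<not> (x < n \<and> y < n) \<or> holds Reach_3 (?r x y) m) \<and>
      (\<exists>x<L. \<exists>y<L. x < n \<and> y < n \<and> (\<not> holds Reach_2 (?r x y) m \<or>
        holds Separable (?r x y) m \<and> \<not> k < sep_cost (adj G) x y))"
      using assms(1)
      by (simp add: Meda_3_def holds_simps holds_Vertex eval_Budget eval_Sep_cost)
    also have "\<dots> \<longleftrightarrow> (\<forall>x<L. \<forall>y<L. x < n \<and> y < n \<longrightarrow> reach (adj G) 3 x y) \<and>
      (\<exists>x<L. \<exists>y<L. x < n \<and> y < n \<and>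
        (\<not> reach (adj G) 2 x y \<or> separable (adj G) x y \<and> sep_cost (adj G) x y \<le> k))"
      unfolding not_less using r by (intro arg_cong2[where f = "(\<and>)"]) meson+
    finally show ?thesis using vertex by blast
  qed
  finally show ?thesis ..
qed

end

theorem theorem4p5: "polytime_solvable meda_encode meda_instances (meda_yes 3)"
proof (rule polytime_solvable_if_exp[OF regs_below_Meda_3])
  fix x assume "x \<in> meda_instances"
  then obtain G k n where x: "x = (G, k)" "simple_graph G" "verts G = {..<n}" "connected_graph G" "0 < k"
    by (auto simp: meda_instances_def)
  interpret meda_input G k n "length (meda_encode (G, k))" "snd (init_state (meda_encode (G, k)))"
    using x by unfold_locales auto
  have "0 < n" using x by (auto simp: connected_graph_def)
  then show "holds Meda_3 (fst (init_state (meda_encode x))) (snd (init_state (meda_encode x))) \<longleftrightarrow>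
      meda_yes 3 x"
    using holds_Meda_3 x by (simp add: init_state_def)
qed simp

end
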